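(* Let $\mathbb{K}$ be a field of characteristic zero and let $R=\mathbb{K}[x,y,z]$ with its standard grading. Let $r$ and $a_1,\dots,a_r$ be positive integers, let $L_1,\dots,L_r\in [R]_1$ be general linear forms such that, for $I=(L_1^{a_1},\dots,L_r^{a_r})$, the quotient $R/I$ is artinian, and let $L\in [R]_1$ be a general linear form. Then for every integer $j$ the multiplication map $$\times L^2:\ [R/I]_{j-2}\longrightarrow [R/I]_{j}$$ has maximal rank, i.e. it is injective or surjective.
   Context: For a graded $R$-module $M$, $[M]_j$ denotes its homogeneous component of degree $j$, a $\mathbb{K}$-vector space (which is $0$ for $M=R/I$ and $j<0$). The quotient $R/I$ is artinian if it is finite-dimensional over $\mathbb{K}$. "General" has the usual meaning: for fixed $r$ and $a_1,\dots,a_r$, there is a nonempty Zariski-open subset $U$ of the affine space $([R]_1)^{r+1}$ of $(r+1)$-tuples of linear forms such that the assertion holds for all $(L_1,\dots,L_r,L)\in U$ for which $R/(L_1^{a_1},\dots,L_r^{a_r})$ is artinian. *)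

theory Defs
  imports
    "HOL-Library.Poly_Mapping"
    "HOL-Library.Numeral_Type"
    "HOL-Library.FuncSet"
    "HOL-Algebra.Embedded_Algebras"
    "HOL-Algebra.QuotRing"
    "HOL-Algebra.Algebraic_Closure_Type"
begin

text \<open>Polynomials over \<open>'k\<close> with variables indexed by \<open>'v\<close>: finitely supported maps from exponent
  vectors to coefficients, with the convolution product of Poly_Mapping.\<close>

type_synonym ('v, 'k) mpoly = "('v \<Rightarrow>\<^sub>0 nat) \<Rightarrow>\<^sub>0 'k"

text \<open>The ring \<open>K[x,y,z]\<close>; the three variables are the elements of the three-element type \<open>3\<close>.\<close>

type_synonym 'k poly3 = "(3, 'k) mpoly"

abbreviation poly3_ring :: "'k::comm_ring_1 poly3 ring"
  where "poly3_ring \<equiv> ring_of_type_algebra"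

definition poly3_const :: "'k \<Rightarrow> 'k::comm_ring_1 poly3"
  where "poly3_const c = Poly_Mapping.single 0 c"

text \<open>The degree is an integer, so that the components of negative degree are zero.\<close>

definition homog :: "int \<Rightarrow> 'k::comm_ring_1 poly3 set"
  where "homog j = {f. \<forall>m\<in>Poly_Mapping.keys f. int (\<Sum>v\<in>UNIV. Poly_Mapping.lookup m v) = j}"

text \<open>The homogeneous component of degree \<open>j\<close> of \<open>R/I\<close>, for a homogeneous ideal \<open>I\<close>: the image of the
  component of degree \<open>j\<close> of \<open>R\<close>.\<close>

definition quot_homog :: "'k::comm_ring_1 poly3 set \<Rightarrow> int \<Rightarrow> 'k poly3 set set"
  where "quot_homog I j = (\<lambda>f. I +>\<^bsub>poly3_ring\<^esub> f) ` homog j"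

definition quot_mult ::
    "'k::comm_ring_1 poly3 set \<Rightarrow> 'k poly3 \<Rightarrow> 'k poly3 set \<Rightarrow> 'k poly3 set"
  where "quot_mult I g C = (I +>\<^bsub>poly3_ring\<^esub> g) \<otimes>\<^bsub>poly3_ring Quot I\<^esub> C"

text \<open>Here artinian means finite-dimensional over the field of constants, which acts on \<open>R/I\<close> through
  its image in \<open>R/I\<close>.\<close>

definition artinian_quot :: "'k::field poly3 set \<Rightarrow> bool"
  where "artinian_quot I \<longleftrightarrow>
    ring.finite_dimension (poly3_ring Quot I)
      (range (\<lambda>c. I +>\<^bsub>poly3_ring\<^esub> poly3_const c)) (carrier (poly3_ring Quot I))"

definition maximal_rank :: "('a \<Rightarrow> 'b) \<Rightarrow> 'a set \<Rightarrow> 'b set \<Rightarrow> bool"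
  where "maximal_rank f A B \<longleftrightarrow> inj_on f A \<or> f ` A = B"

definition power_ideal :: "nat \<Rightarrow> (nat \<Rightarrow> nat) \<Rightarrow> (nat \<Rightarrow> 'k::comm_ring_1 poly3) \<Rightarrow> 'k poly3 set"
  where "power_ideal r a Ls = Idl\<^bsub>poly3_ring\<^esub> ((\<lambda>i. Ls i ^ a i) ` {1..r})"

definition mpoly_eval :: "('v \<Rightarrow> 'k) \<Rightarrow> ('v, 'k::comm_ring_1) mpoly \<Rightarrow> 'k"
  where "mpoly_eval x P = (\<Sum>m\<in>Poly_Mapping.keys P. Poly_Mapping.lookup P m * (\<Prod>v\<in>Poly_Mapping.keys m. x v ^ Poly_Mapping.lookup m v))"

text \<open>The affine space of \<open>n\<close>-tuples of linear forms, and its coordinates: coordinate \<open>(i, v)\<close> is the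
  coefficient of the variable \<open>v\<close> in the \<open>i\<close>-th form.\<close>

definition linear_tuples :: "nat \<Rightarrow> (nat \<Rightarrow> 'k::comm_ring_1 poly3) set"
  where "linear_tuples n = {1..n} \<rightarrow>\<^sub>E homog 1"

definition tuple_coord :: "(nat \<Rightarrow> 'k::comm_ring_1 poly3) \<Rightarrow> nat \<times> 3 \<Rightarrow> 'k"
  where "tuple_coord Ls = (\<lambda>(i, v). Poly_Mapping.lookup (Ls i) (Poly_Mapping.single v 1))"

text \<open>A Zariski-open set is the complement of the common zero locus of a set \<open>S\<close> of polynomials in
  these coordinates.\<close>

definition zariski_open :: "nat \<Rightarrow> (nat \<Rightarrow> 'k::field poly3) set \<Rightarrow> bool"
  where "zariski_open n U \<longleftrightarrow>
    (\<exists>S :: (nat \<times> 3, 'k) mpoly set.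
       (\<forall>P\<in>S. \<forall>m\<in>Poly_Mapping.keys P. Poly_Mapping.keys m \<subseteq> {1..n} \<times> UNIV) \<and>
       U = linear_tuples n - {Ls. \<forall>P\<in>S. mpoly_eval (tuple_coord Ls) P = 0})"

end

theory Submission
  imports Defs "HOL-Computational_Algebra.Polynomial"
begin

text \<open>Write \<open>A = R/I\<close>. Multiplication by \<open>L^2\<close> from \<open>A_(j-2)\<close> to
\<open>A_j\<close> is controlled by the map \<open>\<Psi>_j\<close> that sends \<open>(f_1, ..., f_r)\<close>,
with \<open>f_i\<close> of degree \<open>j - a_i\<close> in \<open>R/(L^2)\<close>, to \<open>\<Sum> L_i^(a_i)
f_i\<close>. If \<open>\<Psi>_j\<close> is surjective, then \<open>R_j = I_j + L^2 R_(j-2)\<close>, so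
multiplication is surjective. If \<open>\<Psi>_j\<close> is injective, then \<open>L^2 g = \<Sum> L_i^(a_i)
f_i\<close> forces \<open>L^2\<close> to divide every \<open>f_i\<close>, and cancelling it shows \<open>g
\<in> I\<close>, so multiplication is injective. It therefore suffices that \<open>\<Psi>_j\<close> is
injective or surjective for general forms. Both conditions are open, so for each \<open>j\<close> it is enough
to exhibit one tuple of forms where one of them holds (\<open>generic_rank_in_degree\<close>).

Take \<open>L = z\<close> and \<open>L_i = l_i + c_i z\<close> with \<open>l_i = x - i y\<close> and
\<open>c_i \<in> {0, 1}\<close>. Modulo \<open>z^2\<close> one has \<open>L_i^a = l_i^a + a c_i l_i^(a-1)
z\<close>, so everything is expressed by binary forms. Let \<open>S\<close> be the ring of binary forms in
\<open>x\<close> and \<open>y\<close>. For powers of pairwise independent linear forms \<open>l_i\<close> in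
\<open>S\<close> the family \<open>l_i^(a_i) S_(j-a_i)\<close> behaves as dimensions predict: the sum is
direct if \<open>\<Sum> max(0, j+1-a_i) \<le> j+1\<close> and is all of \<open>S_j\<close> if the reverse
inequality holds (\<open>linear_powers_independent\<close>, \<open>linear_powers_total\<close>; both need
characteristic zero). Putting \<open>c_i = 1\<close> trades one dimension between the two coefficients of
\<open>1\<close> and \<open>z\<close>: the coefficient of \<open>z\<close> sees \<open>l_i^(a_i-1)\<close>
instead of \<open>l_i^(a_i)\<close>, and what is left over for the constant coefficient is
\<open>l_i^(a_i+1)\<close>. Hence \<open>\<Psi>_j\<close> is injective at this point if both \<open>\<Sum>
max(0, j+1-a_i-c_i) \<le> j+1\<close> and \<open>\<Sum> max(0, j-a_i+c_i) \<le> j\<close>, and surjective if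
both inequalities are reversed (\<open>base_point_injective\<close>, \<open>base_point_total\<close>).
Counting shows that a suitable number of \<open>c_i\<close> equal to \<open>1\<close> always achieves one or
the other (\<open>choose_perturbed_set\<close>).

Only finitely many \<open>j\<close> have to be treated this way. For \<open>r \<ge> 2\<close> surjectivity
holds at \<open>j = a_1 + a_2\<close> and is inherited by all larger \<open>j\<close>. For \<open>r =
1\<close> multiplication is injective in every degree as soon as \<open>L\<close> is not proportional to
\<open>L_1\<close>. The finitely many nonempty open conditions have a common point, because a product of
nonzero polynomial functions over an infinite field does not vanish identically.

All linear algebra is carried out in \<open>K[t][z]\<close>, after setting \<open>x = t\<close> and \<open>y =
1\<close>: forms of degree \<open>j\<close> correspond to polynomials of total degree at most
\<open>j\<close>. In type \<^typ>\<open>'k poly poly\<close> the outer variable is \<open>z\<close> and the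
inner one is \<open>t\<close>.\<close>

section \<open>Powers of linear forms in two variables\<close>

text \<open>For the binary form of degree \<open>j\<close> that dehomogenises to \<open>p\<close>, this is the derivative in the direction
of the zero of \<open>x - q y\<close>. It kills that linear form and lowers the degree by one.\<close>

definition polar_deriv :: "nat \<Rightarrow> 'k \<Rightarrow> 'k::field_char_0 poly \<Rightarrow> 'k poly"
  where "polar_deriv j q p = smult (of_nat j) p - [:-q, 1:] * pderiv p"

lemma polar_deriv_sum: "polar_deriv j q (\<Sum>i\<in>N. f i) = (\<Sum>i\<in>N. polar_deriv j q (f i))"
  by (induction N rule: infinite_finite_induct)
    (simp_all add: polar_deriv_def pderiv_add algebra_simps smult_add_right)

lemma coeff_polar_deriv:
  "coeff (polar_deriv j q p) n = (of_nat j - of_nat n) * coeff p n + q * of_nat (Suc n) * coeff p (Suc n)"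
  by (cases n) (simp_all add: polar_deriv_def coeff_pderiv algebra_simps)

lemma degree_polar_deriv:
  assumes "degree p \<le> Suc j"
  shows "degree (polar_deriv (Suc j) q p) \<le> j"
proof (rule degree_le, intro allI impI)
  fix n assume "j < n"
  then have "n = Suc j \<or> n > Suc j" by linarith
  then show "coeff (polar_deriv (Suc j) q p) n = 0"
    using assms by (auto simp: coeff_polar_deriv coeff_eq_0)
qed

lemma polar_deriv_other_factor:
  "polar_deriv j q ([:-b, 1:] ^ Suc a * g) =
    [:-b, 1:] ^ a * (smult (of_nat j) ([:-b, 1:] * g) - [:-q, 1:] * (smult (of_nat (Suc a)) g + [:-b, 1:] * pderiv g))"
proof -
  have "pderiv [:-b, 1:] = 1" by (simp add: pderiv_pCons)
  then show ?thesis
    unfolding polar_deriv_def pderiv_mult pderiv_power_Suc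
    by (simp add: algebra_simps smult_add_right smult_add_left del: mult_pCons_left mult_pCons_right)
qed

lemma polar_deriv_own_factor:
  "polar_deriv j q ([:-q, 1:] ^ a * g) =
    [:-q, 1:] ^ a * (smult (of_nat j) g - smult (of_nat a) g - [:-q, 1:] * pderiv g)"
proof (cases a)
  case (Suc m)
  have "pderiv [:-q, 1:] = 1" by (simp add: pderiv_pCons)
  then have "pderiv ([:-q, 1:] ^ Suc m * g) =
      [:-q, 1:] ^ Suc m * pderiv g + smult (of_nat (Suc m)) ([:-q, 1:] ^ m * g)"
    unfolding pderiv_mult pderiv_power_Suc by (simp add: mult.commute)
  then show ?thesis
    unfolding polar_deriv_def Suc
    by (simp add: algebra_simps smult_add_right smult_add_left del: mult_pCons_left mult_pCons_right)
qed (simp add: polar_deriv_def)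

text \<open>The kernel consists of the scalar multiples of \<open>(x - q y)^j\<close>. All that is needed of this is that its
nonzero members do not vanish at other points, which follows by comparing orders in \<open>j p = (t - q) p'\<close>.\<close>

lemma polar_deriv_eq_0_imp_no_root:
  assumes "polar_deriv j q p = 0" "p \<noteq> 0" "j > 0" "b \<noteq> q"
  shows "poly p b \<noteq> 0"
proof
  assume root: "poly p b = 0"
  have eq: "smult (of_nat j) p = [:-q, 1:] * pderiv p"
    using assms(1) by (simp add: polar_deriv_def)
  have nz: "pderiv p \<noteq> 0"
    using eq assms(2,3) by (metis mult_zero_right of_nat_eq_0_iff smult_eq_0_iff not_gr_zero)
  have "Polynomial.order b p = Polynomial.order b (smult (of_nat j) p)"
    using assms(3) by (simp add: order_smult)
  also have "\<dots> = Polynomial.order b [:-q, 1:] + Polynomial.order b (pderiv p)"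
    unfolding eq by (rule order_mult) (unfold eq[symmetric], use assms(2,3) in simp)
  also have "Polynomial.order b [:-q, 1:] = 0"
    using assms(4) by (intro order_0I) simp
  finally have "Polynomial.order b p = Polynomial.order b (pderiv p)" by simp
  moreover have "Polynomial.order b p = Suc (Polynomial.order b (pderiv p))"
    using nz root assms(2) by (intro order_pderiv) (auto simp: order_root)
  ultimately show False by simp
qed

text \<open>Induction on \<open>j\<close>. Put \<open>b_i = max(0, j+1-a_i)\<close>, the dimension of the space of cofactors of the \<open>i\<close>-th
power. The polar derivative at \<open>\<alpha> k\<close> lowers \<open>j\<close> by one. It fixes the exponent of the \<open>k\<close>-th power,
so that \<open>b_k\<close> drops by one, and lowers every other exponent, so that the other \<open>b_i\<close> stay the same.
The inequality survives. By induction every summand lies in the kernel of the polar derivative, but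
a nonzero multiple of \<open>t - \<alpha> i\<close> with \<open>i \<noteq> k\<close> does not.\<close>

lemma linear_powers_independent:
  fixes \<alpha> :: "'i \<Rightarrow> 'k::field_char_0" and a :: "'i \<Rightarrow> nat" and g :: "'i \<Rightarrow> 'k poly"
  assumes "finite N" "inj_on \<alpha> N"
    and "(\<Sum>i\<in>N. Suc j - a i) \<le> Suc j"
    and "\<And>i. i \<in> N \<Longrightarrow> g i = 0 \<or> a i + degree (g i) \<le> j"
    and "(\<Sum>i\<in>N. [:-\<alpha> i, 1:] ^ a i * g i) = 0"
    and "i \<in> N"
  shows "g i = 0"
  using assms(3-)
proof (induction j arbitrary: a g i)
  note [simp del] = mult_pCons_left mult_pCons_right
  \<comment> \<open>If the exponent of one power is zero, its cofactors alone already account for the whole bound \<open>Suc j\<close>.\<close>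
  have exponent_0: "g i = 0"
    if sums: "(\<Sum>i\<in>N. Suc j - a i) \<le> Suc j" and deg: "\<And>i. i \<in> N \<Longrightarrow> g i = 0 \<or> a i + degree (g i) \<le> j"
      and eq: "(\<Sum>i\<in>N. [:-\<alpha> i, 1:] ^ a i * g i) = 0" and "i \<in> N" and k: "k \<in> N" "a k = 0"
    for j a and g :: "'i \<Rightarrow> 'k poly" and i k
  proof -
    have others: "g i = 0" if "i \<in> N" "i \<noteq> k" for i
    proof -
      have "(\<Sum>i\<in>{i, k}. Suc j - a i) \<le> Suc j"
        using that k sums by (intro order_trans[OF sum_mono2[OF \<open>finite N\<close>] sums]) auto
      then have "a i > j" using that k by auto
      then show ?thesis using deg[OF that(1)] by auto
    qed
    have "(\<Sum>i\<in>N. [:-\<alpha> i, 1:] ^ a i * g i) = (\<Sum>i\<in>{k}. [:-\<alpha> i, 1:] ^ a i * g i)"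
      using k others by (intro sum.mono_neutral_right) (auto simp: \<open>finite N\<close>)
    then have "g k = 0" using eq k by simp
    then show ?thesis using others \<open>i \<in> N\<close> by blast
  qed
  {
    case 0
    show ?case
    proof (cases "a i = 0")
      case True
      show ?thesis by (rule exponent_0[OF 0 \<open>i \<in> N\<close> True])
    next
      case False
      then show ?thesis using 0(2)[OF \<open>i \<in> N\<close>] by auto
    qed
  }
  {
    case (Suc j)
    show ?case
    proof (cases "(\<exists>k\<in>N. a k = 0) \<or> (\<forall>k\<in>N. a k > Suc j)")
      case True
      then show ?thesis
      proof
        assume "\<exists>k\<in>N. a k = 0"
        then show ?thesis using exponent_0[OF Suc.prems] by blast
      next
        assume "\<forall>k\<in>N. a k > Suc j"
        then show ?thesis using Suc.prems(2)[OF \<open>i \<in> N\<close>] \<open>i \<in> N\<close> by fastforce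
      qed
    next
      case False
      then obtain k where k: "k \<in> N" "a k \<le> Suc j" and pos: "\<And>i. i \<in> N \<Longrightarrow> a i > 0"
        by (meson linorder_not_less neq0_conv)
      \<comment> \<open>Polarise with respect to a power that actually occurs, so that the sum of the \<open>b_i\<close> strictly drops.\<close>
      define D where "D = polar_deriv (Suc j) (\<alpha> k)"
      define a' where "a' i = (if i = k then a i else a i - 1)" for i
      have "\<exists>h. D ([:-\<alpha> i, 1:] ^ a i * g i) = [:-\<alpha> i, 1:] ^ a' i * h" if iN: "i \<in> N" for i
      proof (cases "i = k")
        case True
        show ?thesis unfolding D_def a'_def True using polar_deriv_own_factor[of "Suc j" "\<alpha> k" "a k" "g k"] by auto
      next
        case False
        obtain m where "a i = Suc m" using pos[OF iN] by (cases "a i") auto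
        then show ?thesis using False unfolding D_def a'_def
          using polar_deriv_other_factor[of "Suc j" "\<alpha> k" "\<alpha> i" m "g i"] by (auto simp del: power_Suc)
      qed
      then obtain h where h: "\<And>i. i \<in> N \<Longrightarrow> D ([:-\<alpha> i, 1:] ^ a i * g i) = [:-\<alpha> i, 1:] ^ a' i * h i"
        by metis
      have deg: "h i = 0 \<or> a' i + degree (h i) \<le> j" if "i \<in> N" for i
      proof (cases "h i = 0")
        case False
        have "degree ([:-\<alpha> i, 1:] ^ a i * g i) \<le> Suc j"
          using Suc.prems(2)[OF that] degree_mult_le[of "[:-\<alpha> i, 1:] ^ a i" "g i"]
          by (auto simp: degree_linear_power)
        then have "degree ([:-\<alpha> i, 1:] ^ a' i * h i) \<le> j"
          using degree_polar_deriv h[OF that] unfolding D_def by metis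
        then show ?thesis using False by (simp add: degree_mult_eq degree_linear_power)
      qed simp
      have "(\<Sum>i\<in>N. [:-\<alpha> i, 1:] ^ a' i * h i) = (\<Sum>i\<in>N. D ([:-\<alpha> i, 1:] ^ a i * g i))"
        using h by (intro sum.cong) auto
      also have "\<dots> = D (\<Sum>i\<in>N. [:-\<alpha> i, 1:] ^ a i * g i)"
        unfolding D_def by (rule polar_deriv_sum[symmetric])
      also have "\<dots> = 0" using Suc.prems(3) by (simp add: D_def polar_deriv_def)
      finally have eq: "(\<Sum>i\<in>N. [:-\<alpha> i, 1:] ^ a' i * h i) = 0" .
      have split: "(\<Sum>i\<in>N. f i) = f k + (\<Sum>i\<in>N-{k}. f i)" for f :: "'i \<Rightarrow> nat"
        using k \<open>finite N\<close> by (simp add: sum.remove)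
      have "(\<Sum>i\<in>N-{k}. Suc j - a' i) = (\<Sum>i\<in>N-{k}. Suc (Suc j) - a i)"
      proof (intro sum.cong refl)
        fix x assume "x \<in> N - {k}"
        then show "Suc j - a' x = Suc (Suc j) - a x" using pos[of x] by (auto simp: a'_def)
      qed
      then have "(\<Sum>i\<in>N. Suc j - a' i) < (\<Sum>i\<in>N. Suc (Suc j) - a i)"
        using k by (simp add: split a'_def)
      then have sums: "(\<Sum>i\<in>N. Suc j - a' i) \<le> Suc j"
        using Suc.prems(1) by linarith
      have "h i = 0" if "i \<in> N" for i
        by (rule Suc.IH[OF sums deg eq that])
      then have kernel: "D ([:-\<alpha> i, 1:] ^ a i * g i) = 0" if "i \<in> N" for i
        using h that by simp
      have others: "g i = 0" if "i \<in> N" "i \<noteq> k" for i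
      proof (rule ccontr)
        assume "g i \<noteq> 0"
        then have "poly ([:-\<alpha> i, 1:] ^ a i * g i) (\<alpha> i) \<noteq> 0"
          using kernel that k \<open>inj_on \<alpha> N\<close> unfolding D_def
          by (intro polar_deriv_eq_0_imp_no_root) (auto dest: inj_onD)
        then show False using pos[OF that(1)] by simp
      qed
      have "(\<Sum>i\<in>N. [:-\<alpha> i, 1:] ^ a i * g i) = (\<Sum>i\<in>{k}. [:-\<alpha> i, 1:] ^ a i * g i)"
        using k others by (intro sum.mono_neutral_right) (auto simp: \<open>finite N\<close>)
      then have "g k = 0" using Suc.prems(3) by simp
      then show ?thesis using others \<open>i \<in> N\<close> by blast
    qed
  }
qed

lemma degree_prod_linear_powers:
  "degree (\<Prod>i\<in>N. [:-\<alpha> i, 1::'k::field:] ^ b i) = (\<Sum>i\<in>N. b i)"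
  by (induction N rule: infinite_finite_induct) (simp_all add: degree_mult_eq degree_linear_power)

lemma prod_linear_powers_dvd:
  fixes \<alpha> :: "'i \<Rightarrow> 'k::field"
  assumes "finite N" "inj_on \<alpha> N" "\<And>i. i \<in> N \<Longrightarrow> [:-\<alpha> i, 1:] ^ b i dvd p"
  shows "(\<Prod>i\<in>N. [:-\<alpha> i, 1:] ^ b i) dvd p"
  using assms
proof (induction N rule: finite_induct)
  case (insert k N)
  let ?P = "\<Prod>i\<in>N. [:-\<alpha> i, 1:] ^ b i"
  obtain q where q: "p = ?P * q"
    using insert by (auto elim: dvdE)
  have "poly ?P (\<alpha> k) \<noteq> 0"
    using insert by (auto simp: poly_prod inj_on_def)
  then have ord: "Polynomial.order (\<alpha> k) ?P = 0" by (rule order_0I)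
  have "[:-\<alpha> k, 1:] ^ b k dvd q"
  proof (cases "p = 0")
    case False
    have "[:-\<alpha> k, 1:] ^ b k dvd p" using insert.prems by blast
    then have "b k \<le> Polynomial.order (\<alpha> k) p"
      using False by (simp add: order_divides)
    also have "\<dots> = Polynomial.order (\<alpha> k) q"
      using False ord unfolding q by (subst order_mult) auto
    finally show ?thesis by (simp add: order_divides)
  next
    case True
    moreover have "?P \<noteq> 0" using \<open>poly ?P (\<alpha> k) \<noteq> 0\<close> by (metis poly_0)
    ultimately have "q = 0" using q by (metis mult_eq_0_iff)
    then show ?thesis by simp
  qed
  then show ?case
    using insert q by (auto simp: mult.commute intro: mult_dvd_mono)
qed simp

text \<open>The powers and their multiples span all polynomials of degree at most \<open>j\<close>, stated dually: a
functional \<open>\<eta>\<close> that kills them is zero. This is the apolarity argument. Apply the functional to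
\<open>(t - s)^j\<close> to get a polynomial \<open>G(s)\<close> of degree at most \<open>j\<close>. Expanding \<open>(t - s)^j\<close> around \<open>\<alpha> i\<close>
shows that \<open>G\<close> vanishes at \<open>\<alpha> i\<close> to order \<open>j+1-a_i\<close>, which is too much in total unless \<open>G = 0\<close>.
The coefficients of \<open>G\<close> are those of \<open>\<eta>\<close> up to signs and nonzero binomial coefficients.\<close>

lemma linear_powers_total:
  fixes \<alpha> :: "'i \<Rightarrow> 'k::field_char_0" and a :: "'i \<Rightarrow> nat" and \<eta> :: "nat \<Rightarrow> 'k"
  assumes "finite N" "inj_on \<alpha> N"
    and "(\<Sum>i\<in>N. Suc j - a i) \<ge> Suc j"
    and kills: "\<And>i q. i \<in> N \<Longrightarrow> a i + degree q \<le> j \<Longrightarrow> (\<Sum>k\<le>j. \<eta> k * coeff ([:-\<alpha> i, 1:] ^ a i * q) k) = 0"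
    and "k \<le> j"
  shows "\<eta> k = 0"
proof -
  define E where "E p = (\<Sum>k\<le>j. \<eta> k * coeff p k)" for p
  have E_sum: "E (\<Sum>m\<in>M. f m) = (\<Sum>m\<in>M. E (f m))" for M and f :: "nat \<Rightarrow> 'k poly"
    unfolding E_def coeff_sum sum_distrib_left by (rule sum.swap)
  have E_smult: "E (smult c p) = c * E p" for c p
    unfolding E_def by (simp add: sum_distrib_left mult_ac)
  \<comment> \<open>The expansion of \<open>E ((t - s)^j)\<close> in powers of \<open>b - s\<close>; as a polynomial in \<open>s\<close> it does not depend on \<open>b\<close>.\<close>
  define G where "G b = (\<Sum>m\<le>j. smult (of_nat (j choose m) * E ([:-b, 1:] ^ (j - m))) ([:b, -1:] ^ m))" for b
  have poly_G: "poly (G b) s = E ([:-s, 1:] ^ j)" for b s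
  proof -
    have "[:-s, 1:] ^ j = ([:b - s:] + [:-b, 1:]) ^ j" by simp
    also have "\<dots> = (\<Sum>m\<le>j. of_nat (j choose m) * [:b - s:] ^ m * [:-b, 1:] ^ (j - m))"
      by (rule binomial_ring)
    also have "\<dots> = (\<Sum>m\<le>j. smult (of_nat (j choose m) * (b - s) ^ m) ([:-b, 1:] ^ (j - m)))"
      by (intro sum.cong) (simp_all add: of_nat_poly poly_const_pow mult.commute)
    finally show ?thesis
      by (simp add: G_def poly_sum E_sum E_smult poly_power mult_ac)
  qed
  have G_eq: "G b = G 0" for b
    unfolding poly_eq_poly_eq_iff[symmetric] using poly_G by presburger
  have dvd: "[:-\<alpha> i, 1:] ^ (Suc j - a i) dvd G 0" if "i \<in> N" for i
    unfolding G_eq[of "\<alpha> i", symmetric] unfolding G_def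
  proof (intro dvd_sum)
    fix m assume "m \<in> {..j}"
    show "[:-\<alpha> i, 1:] ^ (Suc j - a i) dvd smult (of_nat (j choose m) * E ([:-\<alpha> i, 1:] ^ (j - m))) ([:\<alpha> i, -1:] ^ m)"
    proof (cases "m < Suc j - a i")
      case True
      then have "E ([:-\<alpha> i, 1:] ^ a i * [:-\<alpha> i, 1:] ^ (j - m - a i)) = 0"
        unfolding E_def by (intro kills that) (auto simp: degree_linear_power)
      moreover have "a i + (j - m - a i) = j - m" using True by linarith
      ultimately have "E ([:-\<alpha> i, 1:] ^ (j - m)) = 0" by (metis power_add)
      then show ?thesis by simp
    next
      case False
      have "[:\<alpha> i, -1:] = - [:-\<alpha> i, 1:]" by simp
      then have "[:-\<alpha> i, 1:] ^ (Suc j - a i) dvd [:\<alpha> i, -1:] ^ m"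
        using False by (metis dvd_minus_iff dvd_power_le dvd_refl not_less)
      then show ?thesis by (rule dvd_smult)
    qed
  qed
  have deg: "degree (G 0) \<le> j"
    unfolding G_def
  proof (intro degree_sum_le)
    fix m assume "m \<in> {..j}"
    have "degree ([:0, -1::'k:] ^ m) \<le> m"
      using degree_power_le[of "[:0, -1::'k:]" m] by simp
    then show "degree (smult (of_nat (j choose m) * E ([:-0, 1:] ^ (j - m))) ([:0, -1:] ^ m)) \<le> j"
      using \<open>m \<in> {..j}\<close> by (intro degree_smult_le[THEN order_trans]) simp
  qed simp
  have "G 0 = 0"
  proof (rule ccontr)
    assume nz: "G 0 \<noteq> 0"
    have "(\<Prod>i\<in>N. [:-\<alpha> i, 1:] ^ (Suc j - a i)) dvd G 0"
      using assms dvd by (intro prod_linear_powers_dvd) auto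
    then have "degree (\<Prod>i\<in>N. [:-\<alpha> i, 1:] ^ (Suc j - a i)) \<le> degree (G 0)"
      using nz by (rule dvd_imp_degree_le)
    then show False using deg assms(3) by (simp only: degree_prod_linear_powers)
  qed
  have X: "[:-0, 1::'k:] ^ n = monom 1 n" for n
    unfolding monom_altdef by simp
  have negX: "[:0, -1::'k:] ^ n = monom ((-1) ^ n) n" for n
  proof -
    have "[:0, -1::'k:] = monom (-1) (Suc 0)" by (simp add: monom_Suc monom_0)
    then show ?thesis by (simp only: monom_power) simp
  qed
  have E_monom: "E (monom 1 k) = \<eta> k"
    using \<open>k \<le> j\<close> unfolding E_def by (simp add: if_distrib cong: if_cong)
  have "coeff (G 0) (j - k) = (\<Sum>m\<le>j. of_nat (j choose m) * E (monom 1 (j - m)) * (if m = j - k then (-1) ^ m else 0))"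
    unfolding G_def coeff_sum X negX coeff_smult coeff_monom ..
  also have "\<dots> = of_nat (j choose (j - k)) * \<eta> k * (-1) ^ (j - k)"
    using \<open>k \<le> j\<close> E_monom by (simp add: if_distrib cong: if_cong)
  finally have "of_nat (j choose (j - k)) * \<eta> k * (-1) ^ (j - k) = 0"
    unfolding \<open>G 0 = 0\<close> by simp
  then show ?thesis
    using \<open>k \<le> j\<close> by (auto simp: binomial_eq_0_iff)
qed

section \<open>Polynomials of bounded total degree in two variables, and the special point\<close>

text \<open>The degree is an integer, as for forms: cofactors of negative degree are zero without a case
distinction.\<close>

definition tdeg_le :: "int \<Rightarrow> 'k::zero poly poly set"
  where "tdeg_le d = {P. \<forall>s p. coeff (coeff P s) p \<noteq> 0 \<longrightarrow> int s + int p \<le> d}"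

lemma tdeg_le_coeff_0: "P \<in> tdeg_le d \<Longrightarrow> int s + int p > d \<Longrightarrow> coeff (coeff P s) p = 0"
  unfolding tdeg_le_def by force

lemma tdeg_le_degree: "P \<in> tdeg_le d \<Longrightarrow> coeff P s = 0 \<or> int s + int (degree (coeff P s)) \<le> d"
  unfolding tdeg_le_def using leading_coeff_0_iff[of "coeff P s"] by blast

lemma tdeg_leI: "(\<And>s. coeff P s \<noteq> 0 \<Longrightarrow> int s + int (degree (coeff P s)) \<le> d) \<Longrightarrow> P \<in> tdeg_le d"
  unfolding tdeg_le_def using le_degree by (smt (verit) coeff_0 mem_Collect_eq of_nat_mono)

lemma coeff_1_mult: "coeff (p * q) (Suc 0) = coeff p 0 * coeff q (Suc 0) + coeff p (Suc 0) * coeff q 0"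
  by (simp add: coeff_mult)

lemma coeff_0_power: "coeff (p ^ n) 0 = coeff p 0 ^ n"
  by (induction n) (simp_all add: coeff_mult_0)

lemma coeff_1_power:
  "coeff ([:u, [:c::'k::field_char_0:]:] ^ n) (Suc 0) = smult (of_nat n * c) (u ^ (n - 1))"
proof (induction n)
  case (Suc n)
  have "coeff ([:u, [:c:]:] ^ Suc n) (Suc 0) = u * smult (of_nat n * c) (u ^ (n - 1)) + [:c:] * u ^ n"
    by (simp only: power_Suc coeff_1_mult Suc.IH coeff_0_power) simp
  also have "u * smult (of_nat n * c) (u ^ (n - 1)) = smult (of_nat n * c) (u ^ n)"
    by (cases n) simp_all
  finally show ?case by (simp add: distrib_right smult_add_left)
qed simp

lemma first_order_0: "coeff ([:u, [:c::'k::field_char_0:]:] ^ n * f) 0 = u ^ n * coeff f 0"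
  by (simp add: coeff_mult_0 coeff_0_power)

lemma first_order_1: "coeff ([:u, [:c::'k::field_char_0:]:] ^ n * f) (Suc 0) =
    u ^ n * coeff f (Suc 0) + smult (of_nat n * c) (u ^ (n - 1) * coeff f 0)"
  by (simp add: coeff_1_mult coeff_0_power coeff_1_power)

text \<open>The form \<open>x - i y + c_i z\<close>, dehomogenised, where \<open>c_i = 1\<close> exactly for \<open>i \<in> T\<close>.\<close>

definition base_form :: "nat set \<Rightarrow> nat \<Rightarrow> 'k::field_char_0 poly poly"
  where "base_form T i = [:[:-of_nat i, 1:], [:of_bool (i \<in> T):]:]"

lemma z2_coeff_0: "coeff ([:0, 1:] ^ 2 * g) 0 = 0" and z2_coeff_1: "coeff ([:0, 1:] ^ 2 * g) (Suc 0) = 0"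
  by (simp_all add: power2_eq_square)

text \<open>Compare the coefficients of \<open>1\<close> and \<open>z\<close>. With \<open>f_i = c_i + d_i z\<close>, the coefficient of \<open>z\<close> is a relation
between the powers \<open>l_i^(a_i-1)\<close> for \<open>i \<in> T\<close> and \<open>l_i^(a_i)\<close> for \<open>i \<notin> T\<close>. Independence in degree
\<open>j - 1\<close> makes its cofactors vanish, so \<open>c_i\<close> is a multiple of \<open>l_i d_i\<close> for \<open>i \<in> T\<close>. The constant
coefficient then becomes a relation between \<open>l_i^(a_i+1)\<close> for \<open>i \<in> T\<close> and \<open>l_i^(a_i)\<close> for \<open>i \<notin> T\<close>, and
independence in degree \<open>j\<close> finishes.\<close>

lemma base_point_injective:
  fixes f :: "nat \<Rightarrow> 'k::field_char_0 poly poly"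
  assumes a: "\<And>i. i \<in> {1..r} \<Longrightarrow> a i > 0" and T: "T \<subseteq> {i\<in>{1..r}. a i \<le> j}" and "j > 0"
    and sum0: "(\<Sum>i=1..r. Suc j - (a i + of_bool (i \<in> T))) \<le> Suc j"
    and sum1: "(\<Sum>i=1..r. j - (a i - of_bool (i \<in> T))) \<le> j"
    and f: "\<And>i. i \<in> {1..r} \<Longrightarrow> f i \<in> tdeg_le (int j - int (a i))"
    and f2: "\<And>i s. i \<in> {1..r} \<Longrightarrow> s \<ge> 2 \<Longrightarrow> coeff (f i) s = 0"
    and eq: "(\<Sum>i=1..r. base_form T i ^ a i * f i) + [:0, 1:] ^ 2 * g = 0"
  shows "(\<forall>i\<in>{1..r}. f i = 0) \<and> g = 0"
proof -
  define l where "l i = [:-of_nat i, 1::'k:]" for i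
  have inj: "inj_on (of_nat :: nat \<Rightarrow> 'k) {1..r}" by (simp add: inj_on_def)
  define c where "c i = coeff (f i) 0" for i
  define d where "d i = coeff (f i) (Suc 0)" for i
  have c: "c i = 0 \<or> a i + degree (c i) \<le> j" and d: "d i = 0 \<or> Suc (a i + degree (d i)) \<le> j" if "i \<in> {1..r}" for i
    using tdeg_le_degree[OF f[OF that], of 0] tdeg_le_degree[OF f[OF that], of 1] by (auto simp: c_def d_def)
  have eq0: "(\<Sum>i=1..r. l i ^ a i * c i) = 0"
    using arg_cong[OF eq, of "\<lambda>P. coeff P 0"]
    by (simp only: coeff_add coeff_sum base_form_def first_order_0 z2_coeff_0 c_def l_def) simp
  have eq1: "(\<Sum>i=1..r. l i ^ a i * d i + smult (of_nat (a i) * of_bool (i \<in> T)) (l i ^ (a i - 1) * c i)) = 0"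
    using arg_cong[OF eq, of "\<lambda>P. coeff P (Suc 0)"]
    by (simp only: coeff_add coeff_sum base_form_def first_order_1 z2_coeff_1 c_def d_def l_def) simp
  \<comment> \<open>The cofactors in the coefficient of \<open>z\<close>, after taking out \<open>l_i^(a_i-1)\<close> for \<open>i \<in> T\<close>.\<close>
  define u where "u i = (if i \<in> T then l i * d i + smult (of_nat (a i)) (c i) else d i)" for i
  have u_0: "u i = 0" if "i \<in> {1..r}" for i
  proof (rule linear_powers_independent[OF _ inj, where j = "j - 1" and a = "\<lambda>i. a i - of_bool (i \<in> T)" and g = u])
    show "(\<Sum>i\<in>{1..r}. Suc (j - 1) - (a i - of_bool (i \<in> T))) \<le> Suc (j - 1)"
      using sum1 \<open>j > 0\<close> by simp
    show "u i = 0 \<or> a i - of_bool (i \<in> T) + degree (u i) \<le> j - 1" if "i \<in> {1..r}" for i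
    proof (cases "i \<in> T")
      case True
      then have "a i > 0" "a i \<le> j" using a T by auto
      have "degree (l i * d i) \<le> j - a i"
        using d[OF that] degree_mult_le[of "l i" "d i"] by (auto simp: l_def)
      moreover have "degree (smult (of_nat (a i)) (c i)) \<le> j - a i"
        using c[OF that] by auto
      ultimately have "degree (u i) \<le> j - a i"
        using True by (auto simp: u_def intro: degree_add_le)
      then show ?thesis using True \<open>a i > 0\<close> \<open>a i \<le> j\<close> by auto
    qed (use d[OF that] in \<open>auto simp: u_def\<close>)
    have "l i ^ (a i - of_bool (i \<in> T)) * u i =
        l i ^ a i * d i + smult (of_nat (a i) * of_bool (i \<in> T)) (l i ^ (a i - 1) * c i)" if "i \<in> {1..r}" for i
      using a[OF that] by (cases "a i") (auto simp: u_def algebra_simps)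
    then have "(\<Sum>i=1..r. l i ^ (a i - of_bool (i \<in> T)) * u i) = 0"
      using eq1 by (simp cong: sum.cong_simp)
    then show "(\<Sum>i\<in>{1..r}. [:-of_nat i, 1:] ^ (a i - of_bool (i \<in> T)) * u i) = 0"
      by (simp only: l_def)
  qed (use that in auto)
  then have c_eq: "c i = smult (- 1 / of_nat (a i)) (l i * d i)" if "i \<in> T" for i
  proof -
    have "i \<in> {1..r}" using that T by auto
    then have "l i * d i + smult (of_nat (a i)) (c i) = 0" and "a i > 0"
      using u_0[of i] that a by (auto simp: u_def)
    then have "smult (of_nat (a i)) (c i) = - (l i * d i)" by (simp add: eq_neg_iff_add_eq_0 add.commute)
    then have "smult (1 / of_nat (a i)) (smult (of_nat (a i)) (c i)) = smult (1 / of_nat (a i)) (- (l i * d i))" by simp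
    then show ?thesis using \<open>a i > 0\<close> by simp
  qed
  have d_eq: "d i = 0" if "i \<in> {1..r}" "i \<notin> T" for i
    using u_0[of i] that by (auto simp: u_def)
  \<comment> \<open>The cofactors in the constant coefficient, after taking out \<open>l_i^(a_i+1)\<close> for \<open>i \<in> T\<close>.\<close>
  define v where "v i = (if i \<in> T then smult (- 1 / of_nat (a i)) (d i) else c i)" for i
  have v: "v i = 0" if "i \<in> {1..r}" for i
  proof (rule linear_powers_independent[OF _ inj sum0, where g = v])
    show "v i = 0 \<or> a i + of_bool (i \<in> T) + degree (v i) \<le> j" if "i \<in> {1..r}" for i
      using c[OF that] d[OF that] by (auto simp: v_def)
    have "l i ^ (a i + of_bool (i \<in> T)) * v i = l i ^ a i * c i" for i
      using c_eq by (auto simp: v_def algebra_simps)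
    then have "(\<Sum>i=1..r. l i ^ (a i + of_bool (i \<in> T)) * v i) = 0"
      using eq0 by simp
    then show "(\<Sum>i\<in>{1..r}. [:-of_nat i, 1:] ^ (a i + of_bool (i \<in> T)) * v i) = 0"
      by (simp only: l_def)
  qed (use that in auto)
  have d0: "d i = 0" if "i \<in> {1..r}" for i
    using v[OF that] d_eq[OF that] a[OF that] by (auto simp: v_def split: if_splits)
  then have c0: "c i = 0" if "i \<in> {1..r}" for i
    using v[OF that] c_eq[of i] that by (auto simp: v_def split: if_splits)
  have f0: "f i = 0" if "i \<in> {1..r}" for i
  proof (rule poly_eqI)
    fix s
    have "s = 0 \<or> s = Suc 0 \<or> s \<ge> 2" by linarith
    then show "coeff (f i) s = coeff 0 s"
      using c0[OF that] d0[OF that] f2[OF that] by (auto simp: c_def d_def)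
  qed
  then have "[:0, 1:] ^ 2 * g = 0" using eq by simp
  then have "g = 0" by (metis mult_eq_0_iff one_neq_zero pCons_eq_0_iff power_eq_0_iff)
  with f0 show ?thesis by blast
qed

text \<open>A functional on the polynomials of total degree at most \<open>j\<close>, given by its values \<open>y s p\<close> on the
monomials \<open>t^p z^s\<close>.\<close>

definition pairing :: "nat \<Rightarrow> (nat \<Rightarrow> nat \<Rightarrow> 'k) \<Rightarrow> 'k::field_char_0 poly poly \<Rightarrow> 'k"
  where "pairing j y P = (\<Sum>(s, p)\<in>{(s, p). s + p \<le> j}. y s p * coeff (coeff P s) p)"

text \<open>The dual of \<open>base_point_injective\<close>, with the two steps in the opposite order. A functional that kills
the image is zero on multiples of \<open>z^2\<close> and is thus a pair of functionals, on the constant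
coefficients and on the coefficients of \<open>z\<close>. Multiples \<open>l_i q\<close> with \<open>i \<in> T\<close> separate the two: the
first one kills \<open>l_i^(a_i+1) q\<close> and is zero by \<open>linear_powers_total\<close> in degree \<open>j\<close>. Then the second one
kills \<open>l_i^(a_i-1) q\<close> and is zero in degree \<open>j - 1\<close>.\<close>

lemma base_point_total:
  fixes y :: "nat \<Rightarrow> nat \<Rightarrow> 'k::field_char_0"
  assumes a: "\<And>i. i \<in> {1..r} \<Longrightarrow> a i > 0" and T: "T \<subseteq> {i\<in>{1..r}. a i \<le> j}" and "j \<ge> 2"
    and sum0: "(\<Sum>i=1..r. Suc j - (a i + of_bool (i \<in> T))) \<ge> Suc j"
    and sum1: "(\<Sum>i=1..r. j - (a i - of_bool (i \<in> T))) \<ge> j"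
    and kills: "\<And>i f. i \<in> {1..r} \<Longrightarrow> f \<in> tdeg_le (int j - int (a i)) \<Longrightarrow> pairing j y (base_form T i ^ a i * f) = 0"
    and kills_z2: "\<And>g. g \<in> tdeg_le (int j - 2) \<Longrightarrow> pairing j y ([:0, 1:] ^ 2 * g) = 0"
    and sp: "s + p \<le> j"
  shows "y s p = 0"
proof -
  define l where "l i = [:-of_nat i, 1::'k:]" for i
  have inj: "inj_on (of_nat :: nat \<Rightarrow> 'k) {1..r}" by (simp add: inj_on_def)
  have fin: "finite {(s, p). s + p \<le> j}"
    by (rule finite_subset[of _ "{..j} \<times> {..j}"]) auto
  have y2: "y s p = 0" if s2: "s \<ge> 2" and "s + p \<le> j" for s p
  proof -
    obtain t where t: "s = Suc (Suc t)"
      using s2 by (metis Suc_le_D numeral_2_eq_2 Suc_le_mono)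
    define g :: "'k poly poly" where "g = monom (monom 1 p) t"
    have "g \<in> tdeg_le (int j - 2)"
      using that t by (auto simp: g_def tdeg_le_def split: if_splits)
    then have "pairing j y ([:0, 1:] ^ 2 * g) = 0" by (rule kills_z2)
    also have "[:0, 1:] ^ 2 * g = monom (monom 1 p) s"
      by (simp add: g_def t power2_eq_square monom_Suc)
    also have "pairing j y (monom (monom 1 p) s) = (\<Sum>sp\<in>{(s, p). s + p \<le> j}. if sp = (s, p) then y s p else 0)"
      unfolding pairing_def by (intro sum.cong) (auto split: if_splits)
    also have "\<dots> = y s p" using that fin by simp
    finally show ?thesis .
  qed
  define E0 where "E0 q = (\<Sum>p\<le>j. y 0 p * coeff q p)" for q
  define E1 where "E1 q = (\<Sum>p\<le>j - 1. y 1 p * coeff q p)" for q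
  have pairing_eq: "pairing j y P = E0 (coeff P 0) + E1 (coeff P (Suc 0))" for P
  proof -
    have "pairing j y P = (\<Sum>(s, p)\<in>{0} \<times> {..j} \<union> {1} \<times> {..j - 1}. y s p * coeff (coeff P s) p)"
      unfolding pairing_def
    proof (intro sum.mono_neutral_right[OF fin] ballI)
      show "{0} \<times> {..j} \<union> {1} \<times> {..j - 1} \<subseteq> {(s, p). s + p \<le> j}" using \<open>j \<ge> 2\<close> by auto
      fix sp assume "sp \<in> {(s, p). s + p \<le> j} - ({0} \<times> {..j} \<union> {1} \<times> {..j - 1})"
      then obtain s p where "sp = (s, p)" "s + p \<le> j" "s \<noteq> 0" "s \<noteq> 1" by (cases sp) auto
      then show "(case sp of (s, p) \<Rightarrow> y s p * coeff (coeff P s) p) = 0" using y2[of s p] by simp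
    qed
    also have "\<dots> = (\<Sum>(s, p)\<in>{0} \<times> {..j}. y s p * coeff (coeff P s) p) + (\<Sum>(s, p)\<in>{1} \<times> {..j - 1}. y s p * coeff (coeff P s) p)"
      by (intro sum.union_disjoint) auto
    finally show ?thesis
      by (simp add: E0_def E1_def sum.cartesian_product[symmetric])
  qed
  have E_0: "E0 0 = 0" "E1 0 = 0" by (simp_all add: E0_def E1_def)
  have E1_smult: "E1 (smult b q) = b * E1 q" for b q
    unfolding E1_def by (simp add: sum_distrib_left mult_ac)
  have const: "[:q:] \<in> tdeg_le d" if "int (degree q) \<le> d" for q :: "'k poly" and d
    using that by (intro tdeg_leI) (auto simp: coeff_pCons split: nat.splits)
  have lin: "[:0, q:] \<in> tdeg_le d" if "int (degree q) + 1 \<le> d" for q :: "'k poly" and d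
    using that by (intro tdeg_leI) (auto simp: coeff_pCons split: nat.splits)
  \<comment> \<open>Test the functional on \<open>f = q\<close> and on \<open>f = q z\<close>.\<close>
  have kill0: "E0 (l i ^ a i * q) + of_nat (a i) * of_bool (i \<in> T) * E1 (l i ^ (a i - 1) * q) = 0"
    if "i \<in> {1..r}" "a i + degree q \<le> j" for i q
    using kills[of i "[:q:]"] that const[of q "int j - int (a i)"]
    unfolding pairing_eq base_form_def first_order_0 first_order_1 l_def by (simp add: E1_smult)
  have kill1: "E1 (l i ^ a i * q) = 0" if "i \<in> {1..r}" "a i + degree q \<le> j - 1" for i q
    using kills[of i "[:0, q:]"] that lin[of q "int j - int (a i)"] \<open>j \<ge> 2\<close>
    unfolding pairing_eq base_form_def first_order_0 first_order_1 l_def by (simp add: E_0)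
  have y0: "y 0 p = 0" if "p \<le> j" for p
  proof (rule linear_powers_total[OF _ inj sum0, where \<eta> = "y 0"])
    fix i and q :: "'k poly" assume i: "i \<in> {1..r}" "a i + of_bool (i \<in> T) + degree q \<le> j"
    have "E0 (l i ^ (a i + of_bool (i \<in> T)) * q) = 0"
    proof (cases "i \<in> T")
      case True
      have "degree (l i * q) \<le> Suc (degree q)"
        using degree_mult_le[of "l i" q] by (simp add: l_def)
      then have 1: "E0 (l i ^ a i * (l i * q)) + of_nat (a i) * E1 (l i ^ (a i - 1) * (l i * q)) = 0"
        using kill0[of i "l i * q"] i True by simp
      have 2: "l i ^ (a i - 1) * (l i * q) = l i ^ a i * q"
        using a[OF i(1)] by (cases "a i") (auto simp: mult_ac)
      have 3: "E1 (l i ^ a i * q) = 0" using i True by (intro kill1) auto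
      have "E0 (l i ^ a i * (l i * q)) = 0" using 1 unfolding 2 3 by simp
      then show ?thesis using True by (simp add: mult_ac)
    qed (use kill0[of i q] i in auto)
    then show "(\<Sum>k\<le>j. y 0 k * coeff ([:-of_nat i, 1:] ^ (a i + of_bool (i \<in> T)) * q) k) = 0"
      by (simp only: E0_def l_def)
  qed (use that in auto)
  then have E0: "E0 q = 0" for q by (simp add: E0_def)
  have y1: "y 1 p = 0" if "p \<le> j - 1" for p
  proof (rule linear_powers_total[OF _ inj, where \<eta> = "y 1" and j = "j - 1" and a = "\<lambda>i. a i - of_bool (i \<in> T)"])
    show "Suc (j - 1) \<le> (\<Sum>i\<in>{1..r}. Suc (j - 1) - (a i - of_bool (i \<in> T)))"
      using sum1 \<open>j \<ge> 2\<close> by simp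
    fix i and q :: "'k poly" assume i: "i \<in> {1..r}" "a i - of_bool (i \<in> T) + degree q \<le> j - 1"
    have "E1 (l i ^ (a i - of_bool (i \<in> T)) * q) = 0"
    proof (cases "i \<in> T")
      case True
      then show ?thesis using kill0[of i q] i a[OF i(1)] E0 \<open>j \<ge> 2\<close> by auto
    qed (use kill1[of i q] i in auto)
    then show "(\<Sum>k\<le>j - 1. y 1 k * coeff ([:-of_nat i, 1:] ^ (a i - of_bool (i \<in> T)) * q) k) = 0"
      by (simp only: E1_def l_def)
  qed (use that in auto)
  have "s = 0 \<or> s = 1 \<or> s \<ge> 2" by linarith
  then show ?thesis using y0 y1 y2 sp by auto
qed

text \<open>Let \<open>N0 = \<Sum> max(0, j+1-a_i)\<close> and \<open>N1 = \<Sum> max(0, j-a_i)\<close>; they differ by the number of \<open>i\<close> with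
\<open>a_i \<le> j\<close>. Perturbing \<open>n\<close> of these turns them into \<open>N0 - n\<close> and \<open>N1 + n\<close>, to be compared with \<open>j+1\<close>
and \<open>j\<close>. If the unperturbed values do not already lie on the same side, then \<open>N0\<close> is too big and \<open>N1\<close>
too small, and the smaller of the two gaps is the right \<open>n\<close>.\<close>

lemma choose_perturbed_set:
  fixes a :: "nat \<Rightarrow> nat"
  assumes "\<And>i. i \<in> {1..r} \<Longrightarrow> a i > 0"
  obtains T where "T \<subseteq> {i\<in>{1..r}. a i \<le> j}"
    and "((\<Sum>i=1..r. Suc j - (a i + of_bool (i \<in> T))) \<le> Suc j \<and> (\<Sum>i=1..r. j - (a i - of_bool (i \<in> T))) \<le> j) \<or>
         ((\<Sum>i=1..r. Suc j - (a i + of_bool (i \<in> T))) \<ge> Suc j \<and> (\<Sum>i=1..r. j - (a i - of_bool (i \<in> T))) \<ge> j)"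
proof -
  define A where "A = {i\<in>{1..r}. a i \<le> j}"
  define N0 where "N0 = (\<Sum>i=1..r. Suc j - a i)"
  define N1 where "N1 = (\<Sum>i=1..r. j - a i)"
  have card_eq: "(\<Sum>i=1..r. of_bool (i \<in> T)) = card T" if "T \<subseteq> A" for T
  proof -
    have "T \<inter> {1..r} = T" using that by (auto simp: A_def)
    then show ?thesis by (simp add: of_bool_def sum.If_cases Int_commute)
  qed
  have sum0: "(\<Sum>i=1..r. Suc j - (a i + of_bool (i \<in> T))) + card T = N0" if "T \<subseteq> A" for T
    unfolding N0_def card_eq[OF that, symmetric] sum.distrib[symmetric]
    using that by (intro sum.cong) (auto simp: A_def)
  have sum1: "(\<Sum>i=1..r. j - (a i - of_bool (i \<in> T))) = N1 + card T" if "T \<subseteq> A" for T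
    unfolding N1_def card_eq[OF that, symmetric] sum.distrib[symmetric]
    using that assms by (intro sum.cong) (force simp: A_def)+
  have N: "N0 = N1 + card A"
    unfolding N0_def N1_def card_eq[OF order_refl, symmetric] sum.distrib[symmetric]
    by (intro sum.cong) (auto simp: A_def)
  have N1_0: "N1 = 0" if "card A = 0"
    using that by (auto simp: A_def N1_def)
  have ex: "\<exists>T\<subseteq>A. card T = n" if "n \<le> card A" for n
    using that by (metis obtain_subset_with_card_n)
  define n where "n = (if N0 \<le> Suc j \<or> N1 \<ge> j then 0 else min (N0 - Suc j) (j - N1))"
  have "n \<le> card A" using N by (auto simp: n_def)
  then obtain T where T: "T \<subseteq> A" "card T = n" using ex by blast
  have "(N0 - n \<le> Suc j \<and> N1 + n \<le> j) \<or> (N0 - n \<ge> Suc j \<and> N1 + n \<ge> j)"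
    using N N1_0 by (cases "card A = 0") (auto simp: n_def min_def)
  then show thesis
    using that[of T] T sum0[OF T(1)] sum1[OF T(1)] unfolding A_def by linarith
qed

section \<open>Evaluation homomorphisms and polynomial functions\<close>

text \<open>Substitution of \<open>\<xi>\<close> for the variables, with coefficients mapped by \<open>\<kappa>\<close>. Both the evaluation of
polynomials at a point and the dehomogenisation of ternary forms are instances.\<close>

definition mpoly_subst :: "('k \<Rightarrow> 'r) \<Rightarrow> ('v \<Rightarrow> 'r) \<Rightarrow> ('v, 'k::comm_ring_1) mpoly \<Rightarrow> 'r::comm_ring_1"
  where "mpoly_subst \<kappa> \<xi> P =
    (\<Sum>m\<in>Poly_Mapping.keys P. \<kappa> (Poly_Mapping.lookup P m) * (\<Prod>v\<in>Poly_Mapping.keys m. \<xi> v ^ Poly_Mapping.lookup m v))"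

lemma mpoly_eval_eq_subst: "mpoly_eval x P = mpoly_subst id x P"
  by (simp add: mpoly_eval_def mpoly_subst_def)

definition monomial_value :: "('v \<Rightarrow> 'r) \<Rightarrow> ('v \<Rightarrow>\<^sub>0 nat) \<Rightarrow> 'r::comm_ring_1"
  where "monomial_value \<xi> m = (\<Prod>v\<in>Poly_Mapping.keys m. \<xi> v ^ Poly_Mapping.lookup m v)"

lemma monomial_value_superset:
  assumes "finite V" "Poly_Mapping.keys m \<subseteq> V"
  shows "monomial_value \<xi> m = (\<Prod>v\<in>V. \<xi> v ^ Poly_Mapping.lookup m v)"
  unfolding monomial_value_def using assms
  by (intro prod.mono_neutral_left) (auto simp: in_keys_iff)

lemma monomial_value_add: "monomial_value \<xi> (m + n) = monomial_value \<xi> m * monomial_value \<xi> n"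
proof -
  let ?V = "Poly_Mapping.keys m \<union> Poly_Mapping.keys n"
  have "Poly_Mapping.keys (m + n) \<subseteq> ?V" by (rule keys_add)
  then show ?thesis
    by (simp add: monomial_value_superset[of ?V] lookup_add power_add prod.distrib)
qed

locale coefficient_hom =
  fixes \<kappa> :: "'k::comm_ring_1 \<Rightarrow> 'r::comm_ring_1"
  assumes hom_0: "\<kappa> 0 = 0" and hom_1: "\<kappa> 1 = 1"
    and hom_add: "\<kappa> (a + b) = \<kappa> a + \<kappa> b" and hom_mult: "\<kappa> (a * b) = \<kappa> a * \<kappa> b"
begin

lemma subst_superset:
  assumes "finite M" "Poly_Mapping.keys P \<subseteq> M"
  shows "mpoly_subst \<kappa> \<xi> P = (\<Sum>m\<in>M. \<kappa> (Poly_Mapping.lookup P m) * monomial_value \<xi> m)"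
  unfolding mpoly_subst_def monomial_value_def[symmetric] using assms
  by (intro sum.mono_neutral_left) (auto simp: in_keys_iff hom_0)

lemma subst_0: "mpoly_subst \<kappa> \<xi> 0 = 0"
  by (simp add: mpoly_subst_def)

lemma subst_add: "mpoly_subst \<kappa> \<xi> (P + Q) = mpoly_subst \<kappa> \<xi> P + mpoly_subst \<kappa> \<xi> Q"
proof -
  let ?M = "Poly_Mapping.keys P \<union> Poly_Mapping.keys Q"
  have "Poly_Mapping.keys (P + Q) \<subseteq> ?M" by (rule keys_add)
  then show ?thesis
    by (simp add: subst_superset[of ?M] lookup_add hom_add distrib_right sum.distrib)
qed

lemma subst_sum: "mpoly_subst \<kappa> \<xi> (\<Sum>i\<in>A. f i) = (\<Sum>i\<in>A. mpoly_subst \<kappa> \<xi> (f i))"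
  by (induction A rule: infinite_finite_induct) (simp_all add: subst_0 subst_add)

lemma subst_single: "mpoly_subst \<kappa> \<xi> (Poly_Mapping.single m c) = \<kappa> c * monomial_value \<xi> m"
  by (subst subst_superset[of "{m}"]) auto

lemma subst_1: "mpoly_subst \<kappa> \<xi> 1 = 1"
  using subst_single[of \<xi> 0 1] by (simp add: hom_1 monomial_value_def)

end

lemma mpoly_sum_monomials:
  "P = (\<Sum>m\<in>Poly_Mapping.keys P. Poly_Mapping.single m (Poly_Mapping.lookup P m))"
  by (rule poly_mapping_eqI) (auto simp: lookup_sum lookup_single when_def in_keys_iff)

context coefficient_hom begin

lemma subst_mult: "mpoly_subst \<kappa> \<xi> (P * Q) = mpoly_subst \<kappa> \<xi> P * mpoly_subst \<kappa> \<xi> Q"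
proof -
  have monomials: "mpoly_subst \<kappa> \<xi> (Poly_Mapping.single m c * Poly_Mapping.single n d) =
      mpoly_subst \<kappa> \<xi> (Poly_Mapping.single m c) * mpoly_subst \<kappa> \<xi> (Poly_Mapping.single n d)" for m n c d
    by (simp add: mult_single subst_single hom_mult monomial_value_add mult_ac)
  have sums: "mpoly_subst \<kappa> \<xi> ((\<Sum>m\<in>A. Poly_Mapping.single m (f m)) * (\<Sum>n\<in>B. Poly_Mapping.single n (g n))) =
      mpoly_subst \<kappa> \<xi> (\<Sum>m\<in>A. Poly_Mapping.single m (f m)) * mpoly_subst \<kappa> \<xi> (\<Sum>n\<in>B. Poly_Mapping.single n (g n))" for A B f g
    by (simp only: sum_product subst_sum monomials)
  show ?thesis
    using sums[of "Poly_Mapping.lookup P" "Poly_Mapping.keys P" "Poly_Mapping.lookup Q" "Poly_Mapping.keys Q"]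
    by (simp only: mpoly_sum_monomials[symmetric])
qed

lemma subst_power: "mpoly_subst \<kappa> \<xi> (P ^ n) = mpoly_subst \<kappa> \<xi> P ^ n"
  by (induction n) (simp_all add: subst_1 subst_mult)

end

interpretation eval_hom: coefficient_hom id
  by unfold_locales simp_all

text \<open>The polynomial functions on affine space with coordinates in \<open>V\<close>. Zariski-open sets are produced from
these rather than from syntactic polynomials, because closure under the operations is immediate.\<close>

inductive polyfun :: "'v set \<Rightarrow> (('v \<Rightarrow> 'k::comm_ring_1) \<Rightarrow> 'k) \<Rightarrow> bool" for V where
  polyfun_const: "polyfun V (\<lambda>x. c)"
| polyfun_coord: "v \<in> V \<Longrightarrow> polyfun V (\<lambda>x. x v)"
| polyfun_add: "polyfun V F \<Longrightarrow> polyfun V G \<Longrightarrow> polyfun V (\<lambda>x. F x + G x)"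
| polyfun_mult: "polyfun V F \<Longrightarrow> polyfun V G \<Longrightarrow> polyfun V (\<lambda>x. F x * G x)"

lemma polyfun_diff:
  assumes "polyfun V F" "polyfun V G" shows "polyfun V (\<lambda>x. F x - G x)"
proof -
  have "polyfun V (\<lambda>x. F x + (-1) * G x)"
    by (intro polyfun_add polyfun_mult polyfun_const assms)
  then show ?thesis by simp
qed

lemma polyfun_sum:
  "(\<And>i. i \<in> A \<Longrightarrow> polyfun V (F i)) \<Longrightarrow> polyfun V (\<lambda>x. \<Sum>i\<in>A. F i x)"
  by (induction A rule: infinite_finite_induct) (auto intro: polyfun_const polyfun_add)

lemma polyfun_line:
  assumes "polyfun V F"
  shows "\<exists>p. \<forall>t. F (\<lambda>v. x v + t * d v) = poly p t"
  using assms
proof induction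
  case (polyfun_const c)
  show ?case by (intro exI[of _ "[:c:]"]) simp
next
  case (polyfun_coord v)
  show ?case by (intro exI[of _ "[:x v, d v:]"]) simp
next
  case (polyfun_add F G)
  then obtain p q where "\<forall>t. F (\<lambda>v. x v + t * d v) = poly p t" "\<forall>t. G (\<lambda>v. x v + t * d v) = poly q t" by blast
  then show ?case by (intro exI[of _ "p + q"]) simp
next
  case (polyfun_mult F G)
  then obtain p q where "\<forall>t. F (\<lambda>v. x v + t * d v) = poly p t" "\<forall>t. G (\<lambda>v. x v + t * d v) = poly q t" by blast
  then show ?case by (intro exI[of _ "p * q"]) simp
qed

text \<open>Two nonempty principal open sets meet: restrict both functions to the line through a point of each.\<close>

lemma polyfun_common_nonzero:
  fixes F G :: "('v \<Rightarrow> 'k::field_char_0) \<Rightarrow> 'k"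
  assumes "polyfun V F" "polyfun V G" "F x \<noteq> 0" "G y \<noteq> 0"
  shows "\<exists>z. F z * G z \<noteq> 0"
proof -
  obtain p q where p: "\<And>t. F (\<lambda>v. x v + t * (y v - x v)) = poly p t"
    and q: "\<And>t. G (\<lambda>v. x v + t * (y v - x v)) = poly q t"
    using polyfun_line[OF assms(1), of x "\<lambda>v. y v - x v"] polyfun_line[OF assms(2), of x "\<lambda>v. y v - x v"] by blast
  have "poly p 0 \<noteq> 0" "poly q 1 \<noteq> 0"
    using p[of 0] q[of 1] assms(3,4) by simp_all
  then have "p * q \<noteq> 0" by auto
  then obtain t where "poly (p * q) t \<noteq> 0"
    using poly_all_0_iff_0 by blast
  then show ?thesis
    using p[of t] q[of t] by (intro exI[of _ "\<lambda>v. x v + t * (y v - x v)"]) simp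
qed

lemma polyfun_prod_nonzero:
  fixes F :: "'i \<Rightarrow> ('v \<Rightarrow> 'k::field_char_0) \<Rightarrow> 'k"
  assumes "finite A" "\<And>i. i \<in> A \<Longrightarrow> polyfun V (F i)" "\<And>i. i \<in> A \<Longrightarrow> \<exists>x. F i x \<noteq> 0"
  shows "\<exists>G. polyfun V G \<and> (\<exists>x. G x \<noteq> 0) \<and> (\<forall>x. G x \<noteq> 0 \<longrightarrow> (\<forall>i\<in>A. F i x \<noteq> 0))"
  using assms
proof (induction A rule: finite_induct)
  case empty
  show ?case by (intro exI[of _ "\<lambda>x. 1"]) (auto intro: polyfun_const)
next
  case (insert i A)
  then obtain G where G: "polyfun V G" "\<exists>x. G x \<noteq> 0" "\<forall>x. G x \<noteq> 0 \<longrightarrow> (\<forall>i\<in>A. F i x \<noteq> 0)"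
    by (metis insertI2)
  then have "\<exists>z. F i z * G z \<noteq> 0"
    using insert.prems polyfun_common_nonzero by (metis insertI1)
  then show ?case
    using G insert.prems by (intro exI[of _ "\<lambda>x. F i x * G x"]) (auto intro: polyfun_mult)
qed

lemma polyfun_mpoly_eval:
  assumes "polyfun V F"
  shows "\<exists>P. (\<forall>m\<in>Poly_Mapping.keys P. Poly_Mapping.keys m \<subseteq> V) \<and> (\<forall>x. mpoly_eval x P = F x)"
  using assms
proof induction
  case (polyfun_const c)
  show ?case
    by (intro exI[of _ "Poly_Mapping.single 0 c"])
      (auto simp: mpoly_eval_eq_subst eval_hom.subst_single monomial_value_def)
next
  case (polyfun_coord v)
  then show ?case
    by (intro exI[of _ "Poly_Mapping.single (Poly_Mapping.single v 1) 1"])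
      (auto simp: mpoly_eval_eq_subst eval_hom.subst_single monomial_value_def split: if_splits)
next
  case (polyfun_add F G)
  then obtain P Q where "\<forall>m\<in>Poly_Mapping.keys P. Poly_Mapping.keys m \<subseteq> V" "\<forall>x. mpoly_eval x P = F x"
    "\<forall>m\<in>Poly_Mapping.keys Q. Poly_Mapping.keys m \<subseteq> V" "\<forall>x. mpoly_eval x Q = G x" by blast
  moreover have "Poly_Mapping.keys m \<subseteq> V" if "m \<in> Poly_Mapping.keys (P + Q)" for m
    using that keys_add[of P Q] calculation by blast
  ultimately show ?case
    by (intro exI[of _ "P + Q"]) (auto simp: mpoly_eval_eq_subst eval_hom.subst_add)
next
  case (polyfun_mult F G)
  then obtain P Q where PQ: "\<forall>m\<in>Poly_Mapping.keys P. Poly_Mapping.keys m \<subseteq> V" "\<forall>x. mpoly_eval x P = F x"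
    "\<forall>m\<in>Poly_Mapping.keys Q. Poly_Mapping.keys m \<subseteq> V" "\<forall>x. mpoly_eval x Q = G x" by blast
  have "Poly_Mapping.keys m \<subseteq> V" if mPQ: "m \<in> Poly_Mapping.keys (P * Q)" for m
  proof -
    obtain m1 m2 where "m = m1 + m2" "m1 \<in> Poly_Mapping.keys P" "m2 \<in> Poly_Mapping.keys Q"
      using mPQ keys_mult[of P Q] by blast
    then show ?thesis using PQ keys_add[of m1 m2] by blast
  qed
  then show ?case
    using PQ by (intro exI[of _ "P * Q"]) (auto simp: mpoly_eval_eq_subst eval_hom.subst_mult)
qed


section \<open>Linear systems whose coefficients are polynomial functions\<close>

text \<open>Rows of the matrix \<open>M\<close> are indexed by \<open>B\<close> and columns by \<open>A\<close>.\<close>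

definition columns_independent :: "'b set \<Rightarrow> 'a set \<Rightarrow> ('b \<Rightarrow> 'a \<Rightarrow> 'k::field) \<Rightarrow> bool"
  where "columns_independent B A M \<longleftrightarrow>
    (\<forall>c. (\<forall>b\<in>B. (\<Sum>a\<in>A. M b a * c a) = 0) \<longrightarrow> (\<forall>a\<in>A. c a = 0))"

lemma columns_independentD:
  assumes "columns_independent B A M" "\<And>b. b \<in> B \<Longrightarrow> (\<Sum>a\<in>A. M b a * c a) = 0" "a \<in> A"
  shows "c a = 0"
  using assms unfolding columns_independent_def by blast

text \<open>Gaussian elimination, one column at a time: at \<open>z\<close> the first column has a nonzero entry, which stays
nonzero on an open set, and clearing its row without division keeps the entries polynomial.\<close>

lemma independence_open:
  fixes M :: "'b \<Rightarrow> 'a \<Rightarrow> ('v \<Rightarrow> 'k::field) \<Rightarrow> 'k"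
  assumes "finite A" "\<And>a b. a \<in> A \<Longrightarrow> b \<in> B \<Longrightarrow> polyfun V (M b a)"
    and "columns_independent B A (\<lambda>b a. M b a z)"
  shows "\<exists>F. polyfun V F \<and> F z \<noteq> 0 \<and> (\<forall>x. F x \<noteq> 0 \<longrightarrow> columns_independent B A (\<lambda>b a. M b a x))"
  using assms
proof (induction A arbitrary: M rule: finite_induct)
  case empty
  show ?case by (intro exI[of _ "\<lambda>x. 1"]) (auto simp: columns_independent_def intro: polyfun_const)
next
  case (insert k A)
  have "\<exists>b\<in>B. M b k z \<noteq> 0"
  proof (rule ccontr)
    assume none: "\<not> ?thesis"
    have "(\<Sum>a\<in>insert k A. M b a z * (if a = k then 1 else 0)) = 0" if "b \<in> B" for b
      using that none insert.hyps by (auto intro!: sum.neutral)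
    from columns_independentD[OF insert.prems(2) this, of k] show False by simp
  qed
  then obtain l where l: "l \<in> B" "M l k z \<noteq> 0" by blast
  \<comment> \<open>Row \<open>l\<close> is the pivot row. Scaling by the pivot avoids division, so the entries remain polynomial.\<close>
  define M' where "M' b a x = M l k x * M b a x - M l a x * M b k x" for b a x
  have sum_M': "(\<Sum>a\<in>A. M' b a x * c a) = M l k x * (\<Sum>a\<in>A. M b a x * c a) - M b k x * (\<Sum>a\<in>A. M l a x * c a)" for b x c
    by (simp add: M'_def algebra_simps sum_subtractf sum_distrib_left)
  have poly: "polyfun V (M' b a)" if "a \<in> A" "b \<in> B" for a b
    unfolding M'_def[abs_def] using that l by (intro polyfun_diff polyfun_mult insert.prems) auto
  have "columns_independent B A (\<lambda>b a. M' b a z)"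
    unfolding columns_independent_def
  proof (intro allI impI)
    fix c assume c: "\<forall>b\<in>B. (\<Sum>a\<in>A. M' b a z * c a) = 0"
    define c' where "c' a = (if a = k then - (\<Sum>a\<in>A. M l a z * c a) / M l k z else c a)" for a
    have pivot: "M b k z * (M l k z * c' k) = - M b k z * (\<Sum>a\<in>A. M l a z * c a)" for b
      using l by (simp add: c'_def)
    have "(\<Sum>a\<in>insert k A. M b a z * c' a) = 0" if "b \<in> B" for b
    proof -
      have "(\<Sum>a\<in>A. M b a z * c' a) = (\<Sum>a\<in>A. M b a z * c a)"
        using insert.hyps by (intro sum.cong) (auto simp: c'_def)
      then have "M l k z * (\<Sum>a\<in>insert k A. M b a z * c' a) =
          M b k z * (M l k z * c' k) + M l k z * (\<Sum>a\<in>A. M b a z * c a)"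
        using insert.hyps by (simp add: algebra_simps)
      also have "\<dots> = (\<Sum>a\<in>A. M' b a z * c a)"
        unfolding pivot sum_M' by simp
      finally have "M l k z * (\<Sum>a\<in>insert k A. M b a z * c' a) = (\<Sum>a\<in>A. M' b a z * c a)" .
      then show ?thesis using c that l by auto
    qed
    from columns_independentD[OF insert.prems(2) this]
    have "\<forall>a\<in>insert k A. c' a = 0" by blast
    then show "\<forall>a\<in>A. c a = 0"
      using insert.hyps by (auto simp: c'_def split: if_splits)
  qed
  from insert.IH[OF poly this]
  obtain F where F: "polyfun V F" "F z \<noteq> 0"
    "\<And>x. F x \<noteq> 0 \<Longrightarrow> columns_independent B A (\<lambda>b a. M' b a x)" by blast
  have "columns_independent B (insert k A) (\<lambda>b a. M b a x)" if x: "M l k x * F x \<noteq> 0" for x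
    unfolding columns_independent_def
  proof (intro allI impI)
    fix c assume c: "\<forall>b\<in>B. (\<Sum>a\<in>insert k A. M b a x * c a) = 0"
    have A_sum: "(\<Sum>a\<in>A. M b a x * c a) = - M b k x * c k" if "b \<in> B" for b
      using c that insert.hyps by (simp add: eq_neg_iff_add_eq_0 add.commute)
    have "\<forall>b\<in>B. (\<Sum>a\<in>A. M' b a x * c a) = 0"
      using l by (simp add: sum_M' A_sum)
    then have zero: "\<forall>a\<in>A. c a = 0"
      using F(3)[of x] x unfolding columns_independent_def by auto
    then have "M l k x * c k = 0" using A_sum[OF l(1)] by simp
    then show "\<forall>a\<in>insert k A. c a = 0" using zero x by auto
  qed
  then show ?case
    using F l insert.prems(1)
    by (intro exI[of _ "\<lambda>x. M l k x * F x"]) (auto intro: polyfun_mult)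
qed

text \<open>Surjectivity is injectivity of the transpose. This lets \<open>independence_open\<close> serve for surjectivity as
well.\<close>

lemma solvable_if_rows_independent:
  fixes M :: "'b \<Rightarrow> 'a \<Rightarrow> 'k::field"
  assumes "finite B" "finite A" "columns_independent A B (\<lambda>a b. M b a)"
  shows "\<exists>c. \<forall>b\<in>B. (\<Sum>a\<in>A. M b a * c a) = d b"
  using assms(1,3)
proof (induction B arbitrary: M d rule: finite_induct)
  case (insert l B)
  have "\<exists>k\<in>A. M l k \<noteq> 0"
  proof (rule ccontr)
    assume none: "\<not> ?thesis"
    have "(\<Sum>b\<in>insert l B. M b a * (if b = l then 1 else 0)) = 0" if "a \<in> A" for a
      using that none insert.hyps by (auto intro!: sum.neutral)
    from columns_independentD[OF insert.prems this, of l] show False by simp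
  qed
  then obtain k where k: "k \<in> A" "M l k \<noteq> 0" by blast
  \<comment> \<open>Column \<open>k\<close> is cleared outside row \<open>l\<close>; the unknown \<open>c k\<close> is then free to satisfy equation \<open>l\<close>.\<close>
  define u where "u b = M b k / M l k" for b
  define M' where "M' b a = M b a - u b * M l a" for b a
  have "columns_independent A B (\<lambda>a b. M' b a)"
    unfolding columns_independent_def
  proof (intro allI impI)
    fix y assume y: "\<forall>a\<in>A. (\<Sum>b\<in>B. M' b a * y b) = 0"
    define y' where "y' b = (if b = l then - (\<Sum>b\<in>B. u b * y b) else y b)" for b
    have "(\<Sum>b\<in>insert l B. M b a * y' b) = 0" if "a \<in> A" for a
    proof -
      have "(\<Sum>b\<in>B. M b a * y' b) = (\<Sum>b\<in>B. M b a * y b)"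
        using insert.hyps by (intro sum.cong) (auto simp: y'_def)
      moreover have "(\<Sum>b\<in>B. M' b a * y b) = (\<Sum>b\<in>B. M b a * y b) - M l a * (\<Sum>b\<in>B. u b * y b)"
        by (simp add: M'_def algebra_simps sum_subtractf sum_distrib_left)
      ultimately show ?thesis using insert.hyps y that by (simp add: y'_def)
    qed
    from columns_independentD[OF insert.prems this]
    have "\<forall>b\<in>insert l B. y' b = 0" by blast
    then show "\<forall>b\<in>B. y b = 0"
      using insert.hyps by (auto simp: y'_def split: if_splits)
  qed
  from insert.IH[OF this, of "\<lambda>b. d b - u b * d l"]
  obtain c where c: "\<And>b. b \<in> B \<Longrightarrow> (\<Sum>a\<in>A. M' b a * c a) = d b - u b * d l" by blast
  define c' where "c' a = (if a = k then (d l - (\<Sum>a\<in>A-{k}. M l a * c a)) / M l k else c a)" for a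
  have split: "(\<Sum>a\<in>A. f a) = f k + (\<Sum>a\<in>A-{k}. f a)" for f :: "'a \<Rightarrow> 'k"
    using k assms(2) by (simp add: sum.remove)
  have tail: "(\<Sum>a\<in>A-{k}. f a * c' a) = (\<Sum>a\<in>A-{k}. f a * c a)" for f
    by (intro sum.cong) (auto simp: c'_def)
  have row_l: "(\<Sum>a\<in>A. M l a * c' a) = d l"
    unfolding split tail using k by (simp add: c'_def)
  have "(\<Sum>a\<in>A. M b a * c' a) = d b" if "b \<in> B" for b
  proof -
    have "M' b k = 0" using k by (simp add: M'_def u_def)
    then have "(\<Sum>a\<in>A. M' b a * c' a) = (\<Sum>a\<in>A. M' b a * c a)"
      unfolding split tail by simp
    then have "(\<Sum>a\<in>A. M' b a * c' a) = d b - u b * d l" using c[OF that] by simp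
    moreover have "(\<Sum>a\<in>A. M' b a * c' a) = (\<Sum>a\<in>A. M b a * c' a) - u b * (\<Sum>a\<in>A. M l a * c' a)"
      by (simp add: M'_def algebra_simps sum_subtractf sum_distrib_left)
    ultimately show ?thesis using row_l by simp
  qed
  then show ?case using row_l by blast
qed simp

section \<open>Injectivity and surjectivity as open conditions on the linear forms\<close>

lemma tdeg_le_0: "0 \<in> tdeg_le d"
  by (simp add: tdeg_le_def)

lemma tdeg_le_add: "P \<in> tdeg_le d \<Longrightarrow> Q \<in> tdeg_le d \<Longrightarrow> P + Q \<in> tdeg_le d"
  unfolding tdeg_le_def by auto (metis add_0)

lemma tdeg_le_sum: "(\<And>i. i \<in> A \<Longrightarrow> f i \<in> tdeg_le d) \<Longrightarrow> (\<Sum>i\<in>A. f i) \<in> tdeg_le d"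
  by (induction A rule: infinite_finite_induct) (auto intro: tdeg_le_0 tdeg_le_add)

lemma tdeg_le_mult:
  assumes "P \<in> tdeg_le d" "Q \<in> tdeg_le e" shows "P * Q \<in> tdeg_le (d + e)"
  unfolding tdeg_le_def
proof (safe, rule ccontr)
  fix s p assume nz: "coeff (coeff (P * Q) s) p \<noteq> 0" and big: "\<not> int s + int p \<le> d + e"
  have "coeff (coeff P i) k * coeff (coeff Q (s - i)) (p - k) = 0" if "i \<le> s" "k \<le> p" for i k
  proof (cases "int i + int k \<le> d")
    case True
    then have "coeff (coeff Q (s - i)) (p - k) = 0"
      using that big assms(2) by (intro tdeg_le_coeff_0) auto
    then show ?thesis by simp
  qed (use tdeg_le_coeff_0[OF assms(1)] in auto)
  then have "coeff (coeff (P * Q) s) p = 0"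
    by (simp add: coeff_mult coeff_sum)
  with nz show False ..
qed

lemma tdeg_le_power:
  assumes "P \<in> tdeg_le 1" shows "P ^ n \<in> tdeg_le (int n)"
proof (induction n)
  case (Suc n)
  from tdeg_le_mult[OF assms this] show ?case by simp
qed (auto simp: tdeg_le_def one_pCons coeff_pCons split: nat.splits)

text \<open>The \<open>i\<close>-th linear form with coordinates \<open>x\<close>, after setting its first variable to \<open>t\<close>, the second to
\<open>1\<close> and the third to \<open>z\<close>.\<close>

definition lin :: "(nat \<times> 3 \<Rightarrow> 'k) \<Rightarrow> nat \<Rightarrow> 'k::field_char_0 poly poly"
  where "lin x i = [:[:x (i, 1), x (i, 0):], [:x (i, 2):]:]"

lemma tdeg_le_lin: "lin x i \<in> tdeg_le 1"
  by (auto simp: tdeg_le_def lin_def coeff_pCons split: nat.splits)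

lemma tdeg_le_lin_power_mult: "f \<in> tdeg_le (d - int e) \<Longrightarrow> lin x i ^ e * f \<in> tdeg_le d"
  using tdeg_le_mult[OF tdeg_le_power[OF tdeg_le_lin, of x i e], of f "d - int e"] by simp

definition supported_on :: "(nat \<times> nat) set \<Rightarrow> 'k::zero poly poly set"
  where "supported_on K = {P. \<forall>s p. coeff (coeff P s) p \<noteq> 0 \<longrightarrow> (s, p) \<in> K}"

lemma tdeg_le_eq_supported: "tdeg_le d = supported_on {(s, p). int s + int p \<le> d}"
  by (simp add: tdeg_le_def supported_on_def)

text \<open>The polynomial with coefficient \<open>c (s, p)\<close> at \<open>t^p z^s\<close> for \<open>(s, p) \<in> K\<close>, written so that it is visibly
a linear combination of monomials.\<close>

definition with_coeffs :: "(nat \<times> nat) set \<Rightarrow> (nat \<times> nat \<Rightarrow> 'k) \<Rightarrow> 'k::comm_ring_1 poly poly"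
  where "with_coeffs K c = (\<Sum>(s, p)\<in>K. smult [:c (s, p):] (monom (monom 1 p) s))"

lemma coeff_with_coeffs:
  assumes "finite K"
  shows "coeff (coeff (with_coeffs K c) s) p = (if (s, p) \<in> K then c (s, p) else 0)"
proof -
  have "coeff (coeff (with_coeffs K c) s) p = (\<Sum>\<kappa>\<in>K. if \<kappa> = (s, p) then c (s, p) else 0)"
    unfolding with_coeffs_def coeff_sum by (intro sum.cong) (auto split: if_splits)
  then show ?thesis using assms by simp
qed

lemma with_coeffs_supported: "finite K \<Longrightarrow> with_coeffs K c \<in> supported_on K"
  by (simp add: supported_on_def coeff_with_coeffs)

lemma poly_poly_eqI: "(\<And>s p. coeff (coeff P s) p = coeff (coeff Q s) p) \<Longrightarrow> P = Q"
  by (intro poly_eqI) auto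

lemma with_coeffs_coeff:
  assumes "finite K" "P \<in> supported_on K"
  shows "with_coeffs K (\<lambda>(s, p). coeff (coeff P s) p) = P"
  using assms by (intro poly_poly_eqI) (auto simp: coeff_with_coeffs supported_on_def)

text \<open>The images of monomials under \<open>(f_i) \<mapsto> \<Sum> L_i^(e_i) f_i\<close>; they are the columns of the matrix of this
map, with polynomial functions of the coordinates of the forms as entries.\<close>

definition column :: "(nat \<Rightarrow> nat) \<Rightarrow> (nat \<times> 3 \<Rightarrow> 'k::field_char_0) \<Rightarrow> nat \<times> nat \<times> nat \<Rightarrow> 'k poly poly"
  where "column e x = (\<lambda>(i, s, p). lin x i ^ e i * monom (monom 1 p) s)"

lemma combination_eq_columns:
  assumes "\<And>i. i \<in> {1..n} \<Longrightarrow> finite (K i)"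
  shows "(\<Sum>i=1..n. lin x i ^ e i * with_coeffs (K i) (c i)) =
    (\<Sum>(i, \<kappa>)\<in>(SIGMA i:{1..n}. K i). smult [:c i \<kappa>:] (column e x (i, \<kappa>)))"
  unfolding with_coeffs_def sum_distrib_left
  by (subst sum.Sigma) (use assms in \<open>auto simp: column_def intro!: sum.cong\<close>)

lemma coeff_combination:
  assumes "\<And>i. i \<in> {1..n} \<Longrightarrow> finite (K i)"
  shows "coeff (coeff (\<Sum>i=1..n. lin x i ^ e i * with_coeffs (K i) (c i)) s) p =
    (\<Sum>\<kappa>\<in>(SIGMA i:{1..n}. K i). coeff (coeff (column e x \<kappa>) s) p * c (fst \<kappa>) (snd \<kappa>))"
proof -
  have "(\<Sum>i=1..n. lin x i ^ e i * with_coeffs (K i) (c i)) =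
      (\<Sum>(i, \<kappa>)\<in>(SIGMA i:{1..n}. K i). smult [:c i \<kappa>:] (column e x (i, \<kappa>)))"
    by (rule combination_eq_columns) (rule assms)
  then show ?thesis
    by (simp only: coeff_sum) (intro sum.cong, auto simp: mult.commute)
qed

lemma polyfun_coeff_mult:
  assumes "\<And>s p. polyfun V (\<lambda>x. coeff (coeff (P x) s) p)" "\<And>s p. polyfun V (\<lambda>x. coeff (coeff (Q x) s) p)"
  shows "polyfun V (\<lambda>x. coeff (coeff (P x * Q x) s) p)"
  unfolding coeff_mult coeff_sum by (intro polyfun_sum polyfun_mult assms)

lemma polyfun_coeff_power:
  assumes "\<And>s p. polyfun V (\<lambda>x. coeff (coeff (P x) s) p)"
  shows "polyfun V (\<lambda>x. coeff (coeff (P x ^ n) s) p)"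
proof (induction n arbitrary: s p)
  case (Suc n)
  show ?case unfolding power_Suc by (intro polyfun_coeff_mult assms Suc)
qed (simp add: polyfun_const)

lemma coeff_affine:
  "coeff (coeff [:[:u, v:], [:w:]:] s) p =
    (if s = 0 then if p = 0 then u else if p = 1 then v else 0 else if s = 1 \<and> p = 0 then w else 0)"
  by (auto simp: coeff_pCons split: nat.splits)

lemma polyfun_coeff_lin:
  assumes "i \<in> {1..n}"
  shows "polyfun ({1..n} \<times> UNIV) (\<lambda>x. coeff (coeff (lin x i) s) p)"
  unfolding lin_def coeff_affine using assms
  by (cases "s = 0"; cases "s = 1"; cases "p = 0"; cases "p = 1") (auto intro!: polyfun_coord polyfun_const)

lemma polyfun_coeff_column:
  assumes "fst \<kappa> \<in> {1..n}"
  shows "polyfun ({1..n} \<times> UNIV) (\<lambda>x. coeff (coeff (column e x \<kappa>) s) p)"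
  unfolding column_def case_prod_beta using assms
  by (intro polyfun_coeff_mult polyfun_coeff_power polyfun_coeff_lin polyfun_const)

text \<open>Injectivity of \<open>(f_i) \<mapsto> \<Sum> L_i^(e_i) f_i\<close> on cofactors with monomials in \<open>K i\<close>. In the applications
the last form is \<open>L\<close>, with exponent \<open>2\<close>.\<close>

definition injective_at :: "nat \<Rightarrow> (nat \<Rightarrow> nat) \<Rightarrow> (nat \<Rightarrow> (nat \<times> nat) set) \<Rightarrow> (nat \<times> 3 \<Rightarrow> 'k::field_char_0) \<Rightarrow> bool"
  where "injective_at n e K x \<longleftrightarrow>
    (\<forall>f. (\<forall>i\<in>{1..n}. f i \<in> supported_on (K i)) \<longrightarrow> (\<Sum>i=1..n. lin x i ^ e i * f i) = 0 \<longrightarrow> (\<forall>i\<in>{1..n}. f i = 0))"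

lemma injective_at_iff:
  assumes "\<And>i. i \<in> {1..n} \<Longrightarrow> finite (K i)"
  shows "injective_at n e K x \<longleftrightarrow>
    columns_independent UNIV (SIGMA i:{1..n}. K i) (\<lambda>(s, p) \<kappa>. coeff (coeff (column e x \<kappa>) s) p)"
proof
  assume inj: "injective_at n e K x"
  show "columns_independent UNIV (SIGMA i:{1..n}. K i) (\<lambda>(s, p) \<kappa>. coeff (coeff (column e x \<kappa>) s) p)"
    unfolding columns_independent_def
  proof (intro allI impI ballI)
    fix c \<kappa> assume c: "\<forall>b\<in>UNIV. (\<Sum>a\<in>(SIGMA i:{1..n}. K i). (case b of (s, p) \<Rightarrow> \<lambda>\<kappa>. coeff (coeff (column e x \<kappa>) s) p) a * c a) = 0"
      and \<kappa>: "\<kappa> \<in> (SIGMA i:{1..n}. K i)"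
    define f where "f i = with_coeffs (K i) (\<lambda>sp. c (i, sp))" for i
    have "(\<Sum>i=1..n. lin x i ^ e i * f i) = 0"
      unfolding f_def by (intro poly_poly_eqI, subst coeff_combination) (use assms c in auto)
    moreover have "\<forall>i\<in>{1..n}. f i \<in> supported_on (K i)"
      using assms by (auto simp: f_def with_coeffs_supported)
    ultimately have "\<forall>i\<in>{1..n}. f i = 0"
      using inj unfolding injective_at_def by blast
    moreover obtain i s p where isp: "\<kappa> = (i, s, p)" "i \<in> {1..n}" "(s, p) \<in> K i" using \<kappa> by (cases \<kappa>) auto
    ultimately have "coeff (coeff (f i) s) p = 0" by simp
    then show "c \<kappa> = 0" using isp assms[of i] by (simp add: f_def coeff_with_coeffs)
  qed
next
  assume ind: "columns_independent UNIV (SIGMA i:{1..n}. K i) (\<lambda>(s, p) \<kappa>. coeff (coeff (column e x \<kappa>) s) p)"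
  show "injective_at n e K x"
    unfolding injective_at_def
  proof (intro allI impI ballI)
    fix f i assume f: "\<forall>i\<in>{1..n}. f i \<in> supported_on (K i)" and eq: "(\<Sum>i=1..n. lin x i ^ e i * f i) = 0" and i: "i \<in> {1..n}"
    define c where "c i = (\<lambda>(s, p). coeff (coeff (f i) s) p)" for i
    have f_eq: "f i = with_coeffs (K i) (c i)" if "i \<in> {1..n}" for i
      using with_coeffs_coeff[of "K i" "f i"] assms f that by (simp add: c_def)
    have eq': "(\<Sum>i=1..n. lin x i ^ e i * with_coeffs (K i) (c i)) = 0"
      using eq f_eq by (simp cong: sum.cong_simp)
    have "c (fst (i, s, p)) (snd (i, s, p)) = 0" if "(s, p) \<in> K i" for s p
      by (rule columns_independentD[OF ind])
        (use eq' i that coeff_combination[where K = K and n = n and x = x and e = e and c = c] assms in auto)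
    then have "coeff (coeff (f i) s) p = 0" for s p
      using f i unfolding supported_on_def c_def by fastforce
    then show "f i = 0"
      by (intro poly_poly_eqI) simp
  qed
qed

lemma injective_at_open:
  fixes x0 :: "nat \<times> 3 \<Rightarrow> 'k::field_char_0"
  assumes "\<And>i. i \<in> {1..n} \<Longrightarrow> finite (K i)" "injective_at n e K x0"
  shows "\<exists>F. polyfun ({1..n} \<times> UNIV) F \<and> F x0 \<noteq> 0 \<and> (\<forall>x. F x \<noteq> 0 \<longrightarrow> injective_at n e K x)"
proof -
  define A where "A = (SIGMA i:{1..n}. K i)"
  define M where "M sp \<kappa> x = coeff (coeff (column e x \<kappa>) (fst sp)) (snd sp)" for \<kappa> sp and x :: "nat \<times> 3 \<Rightarrow> 'k"
  have iff: "injective_at n e K x \<longleftrightarrow> columns_independent UNIV A (\<lambda>sp \<kappa>. M sp \<kappa> x)" for x :: "nat \<times> 3 \<Rightarrow> 'k"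
    unfolding A_def M_def by (subst injective_at_iff) (use assms(1) in \<open>auto simp: case_prod_beta'\<close>)
  have "finite A" using assms(1) by (auto simp: A_def)
  moreover have "polyfun ({1..n} \<times> UNIV) (M sp \<kappa>)" if "\<kappa> \<in> A" for \<kappa> sp
    unfolding M_def[abs_def] using that by (intro polyfun_coeff_column) (auto simp: A_def)
  ultimately show ?thesis
    using independence_open[where A = A and B = UNIV and M = M and z = x0] assms(2) unfolding iff by blast
qed

definition surjective_at :: "nat \<Rightarrow> (nat \<Rightarrow> nat) \<Rightarrow> int \<Rightarrow> (nat \<times> 3 \<Rightarrow> 'k::field_char_0) \<Rightarrow> bool"
  where "surjective_at n e j x \<longleftrightarrow>
    (\<forall>h\<in>tdeg_le j. \<exists>f. (\<forall>i\<in>{1..n}. f i \<in> tdeg_le (j - int (e i))) \<and> h = (\<Sum>i=1..n. lin x i ^ e i * f i))"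

lemma finite_triangle: "finite {(s, p). int s + int p \<le> d}"
  by (rule finite_subset[of _ "{..nat d} \<times> {..nat d}"]) auto

lemma pairing_sum: "pairing j y (\<Sum>i\<in>A. f i) = (\<Sum>i\<in>A. pairing j y (f i))"
proof -
  have "pairing j y (\<Sum>i\<in>A. f i) = (\<Sum>sp\<in>{(s, p). s + p \<le> j}. \<Sum>i\<in>A. (case sp of (s, p) \<Rightarrow> y s p * coeff (coeff (f i) s) p))"
    unfolding pairing_def by (intro sum.cong) (auto simp: coeff_sum sum_distrib_left)
  then show ?thesis unfolding pairing_def by (subst sum.swap) simp
qed

lemma pairing_smult: "pairing j y (smult [:c:] P) = c * pairing j y P"
  unfolding pairing_def sum_distrib_left by (intro sum.cong) auto

text \<open>The hypothesis is the dual form of surjectivity at \<open>x0\<close>, which is what \<open>base_point_total\<close> delivers.\<close>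

lemma surjective_at_open:
  fixes x0 :: "nat \<times> 3 \<Rightarrow> 'k::field_char_0"
  assumes "\<And>y. (\<And>i f. i \<in> {1..n} \<Longrightarrow> f \<in> tdeg_le (int j - int (e i)) \<Longrightarrow> pairing j y (lin x0 i ^ e i * f) = 0) \<Longrightarrow>
      (\<forall>s p. s + p \<le> j \<longrightarrow> y s p = 0)"
  shows "\<exists>F. polyfun ({1..n} \<times> UNIV) F \<and> F x0 \<noteq> 0 \<and> (\<forall>x. F x \<noteq> 0 \<longrightarrow> surjective_at n e (int j) x)"
proof -
  define K where "K i = {(s, p). int s + int p \<le> int j - int (e i)}" for i
  have K: "finite (K i)" for i unfolding K_def by (rule finite_triangle)
  define A where "A = (SIGMA i:{1..n}. K i)"
  define B where "B = {(s, p). s + p \<le> j}"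
  have fin: "finite A" "finite B"
    using K finite_triangle[of "int j"] by (auto simp: A_def B_def simp flip: of_nat_add)
  define M where "M \<kappa> sp x = coeff (coeff (column e x \<kappa>) (fst sp)) (snd sp)" for \<kappa> sp and x :: "nat \<times> 3 \<Rightarrow> 'k"
  have "columns_independent A B (\<lambda>\<kappa> sp. M \<kappa> sp x0)"
    unfolding columns_independent_def
  proof (intro allI impI ballI)
    fix y sp assume y: "\<forall>\<kappa>\<in>A. (\<Sum>sp\<in>B. M \<kappa> sp x0 * y sp) = 0" and sp: "sp \<in> B"
    have col: "pairing j (\<lambda>s p. y (s, p)) (column e x0 \<kappa>) = 0" if "\<kappa> \<in> A" for \<kappa>
      using y that by (simp add: pairing_def M_def B_def case_prod_beta' mult.commute)
    have "pairing j (\<lambda>s p. y (s, p)) (lin x0 i ^ e i * f) = 0" if "i \<in> {1..n}" "f \<in> tdeg_le (int j - int (e i))" for i f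
    proof -
      define c where "c = (\<lambda>(s, p). coeff (coeff f s) p)"
      have "f = with_coeffs (K i) c"
        using with_coeffs_coeff[OF K[of i], of f] that(2) by (simp add: tdeg_le_eq_supported K_def c_def)
      then have "lin x0 i ^ e i * f = (\<Sum>\<kappa>\<in>K i. smult [:c \<kappa>:] (column e x0 (i, \<kappa>)))"
        by (auto simp: with_coeffs_def sum_distrib_left column_def intro!: sum.cong)
      then show ?thesis
        using that(1) by (simp add: pairing_sum pairing_smult col A_def)
    qed
    from assms[OF this] have "\<forall>s p. s + p \<le> j \<longrightarrow> y (s, p) = 0" by blast
    then show "y sp = 0" using sp by (auto simp: B_def)
  qed
  moreover have "polyfun ({1..n} \<times> UNIV) (M \<kappa> sp)" if "\<kappa> \<in> A" for \<kappa> sp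
    unfolding M_def[abs_def] using that by (intro polyfun_coeff_column) (auto simp: A_def)
  ultimately obtain F where F: "polyfun ({1..n} \<times> UNIV) F" "F x0 \<noteq> 0"
      "\<And>x. F x \<noteq> 0 \<Longrightarrow> columns_independent A B (\<lambda>\<kappa> sp. M \<kappa> sp x)"
    using independence_open[OF fin(2), where B = A and M = M and z = x0] by blast
  have "surjective_at n e (int j) x" if Fx: "F x \<noteq> 0" for x
    unfolding surjective_at_def
  proof
    fix h :: "'k poly poly" assume h: "h \<in> tdeg_le (int j)"
    obtain c where c: "\<And>sp. sp \<in> B \<Longrightarrow> (\<Sum>\<kappa>\<in>A. M \<kappa> sp x * c \<kappa>) = coeff (coeff h (fst sp)) (snd sp)"
      using solvable_if_rows_independent[OF fin(2,1), of "\<lambda>sp \<kappa>. M \<kappa> sp x" "\<lambda>sp. coeff (coeff h (fst sp)) (snd sp)"] F(3)[OF Fx]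
      by blast
    define f where "f i = with_coeffs (K i) (\<lambda>sp. c (i, sp))" for i
    have f: "f i \<in> tdeg_le (int j - int (e i))" for i
      unfolding tdeg_le_eq_supported f_def using with_coeffs_supported[OF K] by (simp add: K_def)
    have "h = (\<Sum>i=1..n. lin x i ^ e i * f i)" (is "_ = ?S")
    proof (rule poly_poly_eqI)
      fix s p
      have S: "?S \<in> tdeg_le (int j)" using f by (intro tdeg_le_sum tdeg_le_lin_power_mult)
      show "coeff (coeff h s) p = coeff (coeff ?S s) p"
      proof (cases "s + p \<le> j")
        case True
        then have "coeff (coeff h s) p = (\<Sum>\<kappa>\<in>A. M \<kappa> (s, p) x * c \<kappa>)"
          using c[of "(s, p)"] by (simp add: B_def)
        also have "\<dots> = coeff (coeff ?S s) p"
          unfolding f_def by (subst coeff_combination) (auto simp: K A_def M_def)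
        finally show ?thesis .
      qed (use tdeg_le_coeff_0[OF h] tdeg_le_coeff_0[OF S] in auto)
    qed
    with f show "\<exists>f. (\<forall>i\<in>{1..n}. f i \<in> tdeg_le (int j - int (e i))) \<and> h = (\<Sum>i=1..n. lin x i ^ e i * f i)"
      by blast
  qed
  with F(1,2) show ?thesis by blast
qed

section \<open>Maximal rank for general linear forms, after dehomogenisation\<close>

text \<open>The coordinates of \<open>L_i = x - i y + c_i z\<close> for \<open>i \<le> r\<close>, and of \<open>L_(r+1) = z\<close>.\<close>

definition base_point :: "nat \<Rightarrow> nat set \<Rightarrow> nat \<times> 3 \<Rightarrow> 'k::field_char_0"
  where "base_point r T = (\<lambda>(i, v).
    if i = Suc r then of_bool (v = 2)
    else if v = 0 then 1 else if v = 1 then - of_nat i else of_bool (i \<in> T))"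

lemma lin_base_point: "i \<le> r \<Longrightarrow> lin (base_point r T) i = base_form T i"
  and lin_base_point_last: "lin (base_point r T) (Suc r) = [:0, 1:]"
  by (simp_all add: lin_def base_point_def base_form_def one_pCons)

text \<open>For \<open>i \<le> r\<close> the cofactors have degree at most one in \<open>z\<close>. They represent the classes modulo \<open>L^2\<close>
whenever \<open>z\<close> occurs in \<open>L\<close>, so that the same set of monomials can be used for all nearby forms. The
last cofactor, of \<open>L^2\<close>, is unrestricted.\<close>

definition reduced_support :: "nat \<Rightarrow> (nat \<Rightarrow> nat) \<Rightarrow> nat \<Rightarrow> nat \<Rightarrow> (nat \<times> nat) set"
  where "reduced_support r a j i =
    (if i \<le> r then {(s, p). s \<le> 1 \<and> a i + s + p \<le> j} else {(s, p). s + p + 2 \<le> j})"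

lemma finite_reduced_support: "finite (reduced_support r a j i)"
  by (rule finite_subset[of _ "{..j} \<times> {..j}"]) (auto simp: reduced_support_def split: if_splits)

lemma injective_at_base_point:
  assumes a: "\<And>i. i \<in> {1..r} \<Longrightarrow> a i > 0" and T: "T \<subseteq> {i\<in>{1..r}. a i \<le> j}" and "j > 0"
    and sum0: "(\<Sum>i=1..r. Suc j - (a i + of_bool (i \<in> T))) \<le> Suc j"
    and sum1: "(\<Sum>i=1..r. j - (a i - of_bool (i \<in> T))) \<le> j"
  shows "injective_at (Suc r) (a(Suc r := 2)) (reduced_support r a j) (base_point r T :: _ \<Rightarrow> 'k::field_char_0)"
  unfolding injective_at_def
proof (intro allI impI)
  fix f :: "nat \<Rightarrow> 'k poly poly"
  assume f: "\<forall>i\<in>{1..Suc r}. f i \<in> supported_on (reduced_support r a j i)"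
    and eq: "(\<Sum>i=1..Suc r. lin (base_point r T) i ^ (a(Suc r := 2)) i * f i) = 0"
  have "(\<Sum>i=1..Suc r. lin (base_point r T) i ^ (a(Suc r := 2)) i * f i) =
      (\<Sum>i=1..r. base_form T i ^ a i * f i) + [:0, 1:] ^ 2 * f (Suc r)"
    by (simp add: lin_base_point lin_base_point_last)
  then have eq': "(\<Sum>i=1..r. base_form T i ^ a i * f i) + [:0, 1:] ^ 2 * f (Suc r) = 0"
    using eq by simp
  have supp: "s \<le> 1 \<and> a i + s + p \<le> j" if "i \<in> {1..r}" "coeff (coeff (f i) s) p \<noteq> 0" for i s p
  proof -
    have "f i \<in> supported_on (reduced_support r a j i)" using f that(1) by auto
    then show ?thesis using that by (fastforce simp: supported_on_def reduced_support_def)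
  qed
  have "f i \<in> tdeg_le (int j - int (a i))" if "i \<in> {1..r}" for i
    unfolding tdeg_le_def using supp[OF that] by force
  moreover have "coeff (f i) s = 0" if "i \<in> {1..r}" "s \<ge> 2" for i s
    using supp[OF that(1)] that(2) by (intro poly_eqI) force
  ultimately have "(\<forall>i\<in>{1..r}. f i = 0) \<and> f (Suc r) = 0"
    by (intro base_point_injective[of r a T j, OF a T \<open>j > 0\<close> sum0 sum1 _ _ eq'])
  then show "\<forall>i\<in>{1..Suc r}. f i = 0" by (auto simp: le_Suc_eq)
qed

lemma surjective_near_base_point:
  assumes a: "\<And>i. i \<in> {1..r} \<Longrightarrow> a i > 0" and T: "T \<subseteq> {i\<in>{1..r}. a i \<le> j}" and "j \<ge> 2"
    and sum0: "(\<Sum>i=1..r. Suc j - (a i + of_bool (i \<in> T))) \<ge> Suc j"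
    and sum1: "(\<Sum>i=1..r. j - (a i - of_bool (i \<in> T))) \<ge> j"
  shows "\<exists>F. polyfun ({1..Suc r} \<times> UNIV) F \<and> F (base_point r T :: _ \<Rightarrow> 'k::field_char_0) \<noteq> 0 \<and>
    (\<forall>x. F x \<noteq> 0 \<longrightarrow> surjective_at (Suc r) (a(Suc r := 2)) (int j) x)"
proof (rule surjective_at_open)
  fix y :: "nat \<Rightarrow> nat \<Rightarrow> 'k"
  assume y: "\<And>i f. i \<in> {1..Suc r} \<Longrightarrow> f \<in> tdeg_le (int j - int ((a(Suc r := 2)) i)) \<Longrightarrow>
    pairing j y (lin (base_point r T) i ^ (a(Suc r := 2)) i * f) = 0"
  have "pairing j y (base_form T i ^ a i * f) = 0" if "i \<in> {1..r}" "f \<in> tdeg_le (int j - int (a i))" for i f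
    using y[of i f] that by (simp add: lin_base_point)
  moreover have "pairing j y ([:0, 1:] ^ 2 * g) = 0" if "g \<in> tdeg_le (int j - 2)" for g
    using y[of "Suc r" g] that by (simp add: lin_base_point_last)
  ultimately show "\<forall>s p. s + p \<le> j \<longrightarrow> y s p = 0"
    using base_point_total[of r a T j y, OF a T \<open>j \<ge> 2\<close> sum0 sum1] by blast
qed

lemma generic_rank_in_degree:
  assumes a: "\<And>i. i \<in> {1..r} \<Longrightarrow> a i > 0" and "j \<ge> 2"
  shows "\<exists>F. polyfun ({1..Suc r} \<times> UNIV) F \<and> (\<exists>x. F x \<noteq> 0) \<and>
    (\<forall>x :: nat \<times> 3 \<Rightarrow> 'k::field_char_0. F x \<noteq> 0 \<longrightarrow>
      injective_at (Suc r) (a(Suc r := 2)) (reduced_support r a j) x \<or> surjective_at (Suc r) (a(Suc r := 2)) (int j) x)"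
proof -
  obtain T where T: "T \<subseteq> {i\<in>{1..r}. a i \<le> j}"
    and or: "((\<Sum>i=1..r. Suc j - (a i + of_bool (i \<in> T))) \<le> Suc j \<and> (\<Sum>i=1..r. j - (a i - of_bool (i \<in> T))) \<le> j) \<or>
         ((\<Sum>i=1..r. Suc j - (a i + of_bool (i \<in> T))) \<ge> Suc j \<and> (\<Sum>i=1..r. j - (a i - of_bool (i \<in> T))) \<ge> j)"
    using choose_perturbed_set[of r a j, OF a] by blast
  from or show ?thesis
  proof
    assume "(\<Sum>i=1..r. Suc j - (a i + of_bool (i \<in> T))) \<le> Suc j \<and> (\<Sum>i=1..r. j - (a i - of_bool (i \<in> T))) \<le> j"
    then have "injective_at (Suc r) (a(Suc r := 2)) (reduced_support r a j) (base_point r T :: _ \<Rightarrow> 'k)"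
      using a T \<open>j \<ge> 2\<close> by (intro injective_at_base_point) auto
    from injective_at_open[OF finite_reduced_support this] show ?thesis by blast
  next
    assume "(\<Sum>i=1..r. Suc j - (a i + of_bool (i \<in> T))) \<ge> Suc j \<and> (\<Sum>i=1..r. j - (a i - of_bool (i \<in> T))) \<ge> j"
    then have "\<exists>F. polyfun ({1..Suc r} \<times> UNIV) F \<and> F (base_point r T :: _ \<Rightarrow> 'k) \<noteq> 0 \<and>
        (\<forall>x. F x \<noteq> 0 \<longrightarrow> surjective_at (Suc r) (a(Suc r := 2)) (int j) x)"
      using a T \<open>j \<ge> 2\<close> by (intro surjective_near_base_point) auto
    then show ?thesis by blast
  qed
qed

text \<open>In this degree two of the powers already suffice: \<open>l_1^(a_1)\<close> and \<open>l_2^(a_2)\<close> generate all binary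
forms of degree at least \<open>a_1 + a_2 - 1\<close>.\<close>

lemma generic_surjective_in_large_degree:
  assumes a: "\<And>i. i \<in> {1..r} \<Longrightarrow> a i > 0" and "r \<ge> 2"
  shows "\<exists>F. polyfun ({1..Suc r} \<times> UNIV) F \<and> (\<exists>x. F x \<noteq> 0) \<and>
    (\<forall>x :: nat \<times> 3 \<Rightarrow> 'k::field_char_0. F x \<noteq> 0 \<longrightarrow> surjective_at (Suc r) (a(Suc r := 2)) (int (a 1 + a 2)) x)"
proof -
  define j where "j = a 1 + a 2"
  have pos: "a 1 > 0" "a 2 > 0" using a[of 1] a[of 2] \<open>r \<ge> 2\<close> by auto
  have two: "f 1 + f 2 \<le> (\<Sum>i=1..r. f i)" for f :: "nat \<Rightarrow> nat"
    using sum_mono2[of "{1..r}" "{1, 2}" f] \<open>r \<ge> 2\<close> by auto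
  have "\<exists>F. polyfun ({1..Suc r} \<times> UNIV) F \<and> F (base_point r {} :: _ \<Rightarrow> 'k) \<noteq> 0 \<and>
        (\<forall>x. F x \<noteq> 0 \<longrightarrow> surjective_at (Suc r) (a(Suc r := 2)) (int j) x)"
  proof (rule surjective_near_base_point[of r a "{}" j, OF a])
    show "Suc j \<le> (\<Sum>i=1..r. Suc j - (a i + of_bool (i \<in> {})))"
      using pos by (intro order_trans[OF _ two]) (auto simp: j_def)
    show "j \<le> (\<Sum>i=1..r. j - (a i - of_bool (i \<in> {})))"
      using pos by (intro order_trans[OF _ two]) (auto simp: j_def)
  qed (use pos in \<open>auto simp: j_def\<close>)
  then show ?thesis unfolding j_def by blast
qed

lemma surjective_at_Suc:
  fixes x :: "nat \<times> 3 \<Rightarrow> 'k::field_char_0"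
  assumes "surjective_at n e j x" "j \<ge> 0"
  shows "surjective_at n e (j + 1) x"
  unfolding surjective_at_def
proof
  fix h :: "'k poly poly" assume h: "h \<in> tdeg_le (j + 1)"
  obtain h0 C where hC: "h = pCons h0 C" by (cases h)
  obtain k B where hB: "h0 = pCons k B" by (cases h0)
  \<comment> \<open>A polynomial of total degree \<open>j + 1\<close> is a constant plus multiples of \<open>t\<close> and \<open>z\<close>, with cofactors of total degree \<open>j\<close>.\<close>
  have dec: "h = [:[:k:]:] + [:[:0, 1:]:] * [:B:] + [:0, 1:] * C"
    by (simp add: hC hB)
  have "C \<in> tdeg_le j"
    unfolding tdeg_le_def
  proof safe
    fix s p assume "coeff (coeff C s) p \<noteq> 0"
    then have "coeff (coeff h (Suc s)) p \<noteq> 0" by (simp add: hC)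
    then show "int s + int p \<le> j" using h unfolding tdeg_le_def by fastforce
  qed
  moreover have "[:B:] \<in> tdeg_le j"
    unfolding tdeg_le_def
  proof safe
    fix s p assume nz: "coeff (coeff [:B:] s) p \<noteq> 0"
    then have "s = 0" "coeff (coeff h 0) (Suc p) \<noteq> 0"
      by (auto simp: hC hB coeff_pCons split: nat.splits)
    then show "int s + int p \<le> j" using h unfolding tdeg_le_def by fastforce
  qed
  moreover have "[:[:k:]:] \<in> tdeg_le j"
    using \<open>j \<ge> 0\<close> by (auto simp: tdeg_le_def coeff_pCons split: nat.splits)
  ultimately obtain fA fB fC where
    fA: "\<forall>i\<in>{1..n}. fA i \<in> tdeg_le (j - int (e i))" "[:[:k:]:] = (\<Sum>i=1..n. lin x i ^ e i * fA i)" and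
    fB: "\<forall>i\<in>{1..n}. fB i \<in> tdeg_le (j - int (e i))" "[:B:] = (\<Sum>i=1..n. lin x i ^ e i * fB i)" and
    fC: "\<forall>i\<in>{1..n}. fC i \<in> tdeg_le (j - int (e i))" "C = (\<Sum>i=1..n. lin x i ^ e i * fC i)"
    using bspec[OF assms(1)[unfolded surjective_at_def], of "[:[:k:]:]"]
      bspec[OF assms(1)[unfolded surjective_at_def], of "[:B:]"]
      bspec[OF assms(1)[unfolded surjective_at_def], of C] by blast
  define f where "f i = fA i + [:[:0, 1:]:] * fB i + [:0, 1:] * fC i" for i
  have vars: "[:[:0, 1::'k:]:] \<in> tdeg_le 1" "[:0, 1::'k poly:] \<in> tdeg_le 1"
    by (auto simp: tdeg_le_def coeff_pCons one_pCons split: nat.splits)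
  have "f i \<in> tdeg_le (j + 1 - int (e i))" if "i \<in> {1..n}" for i
  proof -
    have "fA i \<in> tdeg_le (j + 1 - int (e i))"
      using fA(1) that by (fastforce simp: tdeg_le_def)
    then show ?thesis
      using tdeg_le_mult[OF vars(1), of "fB i" "j - int (e i)"] tdeg_le_mult[OF vars(2), of "fC i" "j - int (e i)"] fB(1) fC(1) that
      unfolding f_def by (intro tdeg_le_add) (auto simp: algebra_simps)
  qed
  moreover have "h = (\<Sum>i=1..n. lin x i ^ e i * f i)"
  proof -
    have "lin x i ^ e i * f i = lin x i ^ e i * fA i + [:[:0, 1:]:] * (lin x i ^ e i * fB i) + [:0, 1:] * (lin x i ^ e i * fC i)" for i
      unfolding f_def distrib_left by (simp only: mult.left_commute)
    then have "(\<Sum>i=1..n. lin x i ^ e i * f i) = [:[:k:]:] + [:[:0, 1:]:] * [:B:] + [:0, 1:] * C"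
      unfolding fA(2) fB(2) fC(2) by (simp only: sum.distrib sum_distrib_left)
    then show ?thesis using dec by simp
  qed
  ultimately show "\<exists>f. (\<forall>i\<in>{1..n}. f i \<in> tdeg_le (j + 1 - int (e i))) \<and> h = (\<Sum>i=1..n. lin x i ^ e i * f i)"
    by blast
qed

lemma surjective_at_mono:
  assumes "surjective_at n e j x" "0 \<le> j" "j \<le> k"
  shows "surjective_at n e k x"
  using assms(3)
proof (induction k rule: int_ge_induct)
  case (step k)
  then show ?case using assms(2) by (intro surjective_at_Suc) auto
qed (fact assms(1))

text \<open>Long division by the square of \<open>u + c z\<close>, whose leading coefficient \<open>c^2\<close> in \<open>z\<close> is invertible,
respects total degrees.\<close>

lemma division_by_square:
  fixes P :: "'k::field_char_0 poly poly"
  assumes "c \<noteq> 0" "[:u, [:c:]:] \<in> tdeg_le 1" "P \<in> tdeg_le d"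
  obtains b q where "P = b + [:u, [:c:]:] ^ 2 * q" "b \<in> tdeg_le d" "q \<in> tdeg_le (d - 2)" "\<And>s. s \<ge> 2 \<Longrightarrow> coeff b s = 0"
proof -
  define l where "l = [:u, [:c:]:]"
  have l2: "coeff (l ^ 2) 2 = [:c ^ 2:]" "\<And>s. s > 2 \<Longrightarrow> coeff (l ^ 2) s = 0"
  proof -
    have "l ^ 2 = [:u * u, u * [:c:] + [:c:] * u, [:c:] * [:c:]:]"
      by (simp add: l_def power2_eq_square)
    then show "coeff (l ^ 2) 2 = [:c ^ 2:]" "\<And>s. s > 2 \<Longrightarrow> coeff (l ^ 2) s = 0"
      by (auto simp: coeff_pCons power2_eq_square numeral_2_eq_2 split: nat.splits)
  qed
  have tdeg_l2: "l ^ 2 * Q \<in> tdeg_le d" if "Q \<in> tdeg_le (d - 2)" for Q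
    using tdeg_le_mult[OF tdeg_le_power[OF assms(2), of 2] that] by (simp add: l_def)
  have "\<exists>b q. P = b + l ^ 2 * q \<and> b \<in> tdeg_le d \<and> q \<in> tdeg_le (d - 2) \<and> (\<forall>s\<ge>2. coeff b s = 0)"
    if "\<forall>s\<ge>n + 2. coeff P s = 0" "P \<in> tdeg_le d" for n and P :: "'k poly poly"
    using that
  proof (induction n arbitrary: P)
    case 0
    then show ?case by (intro exI[of _ P] exI[of _ 0]) (auto simp: tdeg_le_0)
  next
    case (Suc n)
    \<comment> \<open>The multiple of the square that cancels the leading term of \<open>P\<close> in \<open>z\<close>.\<close>
    define t where "t = monom (smult (1 / c ^ 2) (coeff P (n + 2))) n"
    have t: "t \<in> tdeg_le (d - 2)"
      using tdeg_le_coeff_0[OF Suc.prems(2), of "n + 2"] by (force simp: tdeg_le_def t_def split: if_splits)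
    have t': "- t \<in> tdeg_le (d - 2)" using t by (simp add: tdeg_le_def)
    have "coeff (P + l ^ 2 * (- t)) s = 0" if "s \<ge> n + 2" for s
    proof (cases "s = n + 2")
      case True
      then show ?thesis
        using \<open>c \<noteq> 0\<close> by (simp add: t_def mult.commute[of "l ^ 2"] coeff_monom_mult l2)
    next
      case False
      then show ?thesis
        using that Suc.prems(1) by (simp add: t_def mult.commute[of "l ^ 2"] coeff_monom_mult l2)
    qed
    moreover have "P + l ^ 2 * (- t) \<in> tdeg_le d"
      using Suc.prems(2) tdeg_l2[OF t'] by (rule tdeg_le_add)
    ultimately obtain b q where bq: "P + l ^ 2 * (- t) = b + l ^ 2 * q" "b \<in> tdeg_le d" "q \<in> tdeg_le (d - 2)" "\<forall>s\<ge>2. coeff b s = 0"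
      using Suc.IH[of "P + l ^ 2 * (- t)"] by auto
    then have "P = b + l ^ 2 * (q + t)" by (simp add: algebra_simps)
    then show ?case using bq t tdeg_le_add by blast
  qed
  from this[of "degree P" P] show thesis
    using that assms(3) unfolding l_def by (auto simp: coeff_eq_0)
qed

text \<open>Injectivity of multiplication by \<open>L^2\<close> from degree \<open>j - 2\<close> to degree \<open>j\<close> of the quotient by the powers,
where \<open>L\<close> is the form with index \<open>r + 1\<close>, expressed for dehomogenised forms.\<close>

definition square_injective :: "nat \<Rightarrow> (nat \<Rightarrow> nat) \<Rightarrow> int \<Rightarrow> (nat \<times> 3 \<Rightarrow> 'k::field_char_0) \<Rightarrow> bool"
  where "square_injective r a j x \<longleftrightarrow>
    (\<forall>f g. (\<forall>i\<in>{1..r}. f i \<in> tdeg_le (j - int (a i))) \<longrightarrow> g \<in> tdeg_le (j - 2) \<longrightarrow>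
      lin x (Suc r) ^ 2 * g = (\<Sum>i=1..r. lin x i ^ a i * f i) \<longrightarrow>
      (\<exists>q. (\<forall>i\<in>{1..r}. q i \<in> tdeg_le (j - 2 - int (a i))) \<and> g = (\<Sum>i=1..r. lin x i ^ a i * q i)))"

text \<open>Replace the cofactors \<open>f_i\<close> by their remainders modulo \<open>L^2\<close>. Injectivity makes the resulting relation
trivial, and its last entry says that \<open>g\<close> is the combination of the powers with the quotients as
cofactors.\<close>

lemma square_injective_if_injective_at:
  fixes x :: "nat \<times> 3 \<Rightarrow> 'k::field_char_0"
  assumes inj: "injective_at (Suc r) (a(Suc r := 2)) (reduced_support r a j) x" and nz: "x (Suc r, 2) \<noteq> 0"
  shows "square_injective r a (int j) x"
  unfolding square_injective_def
proof (intro allI impI)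
  fix f g assume f: "\<forall>i\<in>{1..r}. f i \<in> tdeg_le (int j - int (a i))" and g: "g \<in> tdeg_le (int j - 2)"
    and eq: "lin x (Suc r) ^ 2 * g = (\<Sum>i=1..r. lin x i ^ a i * f i)"
  define L where "L = lin x (Suc r)"
  have "\<exists>b q. f i = b + L ^ 2 * q \<and> b \<in> tdeg_le (int j - int (a i)) \<and> q \<in> tdeg_le (int j - int (a i) - 2) \<and> (\<forall>s\<ge>2. coeff b s = 0)"
    if "i \<in> {1..r}" for i
    using division_by_square[OF nz, of "[:x (Suc r, 1), x (Suc r, 0):]" "f i" "int j - int (a i)"] f that tdeg_le_lin[of x "Suc r"]
    unfolding L_def lin_def by metis
  then obtain b q where bq: "\<And>i. i \<in> {1..r} \<Longrightarrow> f i = b i + L ^ 2 * q i"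
    "\<And>i. i \<in> {1..r} \<Longrightarrow> b i \<in> tdeg_le (int j - int (a i))" "\<And>i. i \<in> {1..r} \<Longrightarrow> q i \<in> tdeg_le (int j - int (a i) - 2)"
    "\<And>i s. i \<in> {1..r} \<Longrightarrow> s \<ge> 2 \<Longrightarrow> coeff (b i) s = 0"
    by metis
  define Q where "Q = (\<Sum>i=1..r. lin x i ^ a i * q i)"
  have Q: "Q \<in> tdeg_le (int j - 2)"
    unfolding Q_def using bq(3) by (intro tdeg_le_sum tdeg_le_lin_power_mult) (simp add: algebra_simps)
  define F where "F = b(Suc r := Q - g)"
  have "(\<Sum>i=1..r. lin x i ^ a i * f i) = (\<Sum>i=1..r. lin x i ^ a i * b i + L ^ 2 * (lin x i ^ a i * q i))"
    by (intro sum.cong) (simp_all add: bq(1) algebra_simps)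
  then have "(\<Sum>i=1..r. lin x i ^ a i * f i) = (\<Sum>i=1..r. lin x i ^ a i * b i) + L ^ 2 * Q"
    by (simp add: sum.distrib sum_distrib_left Q_def)
  then have "(\<Sum>i=1..r. lin x i ^ a i * b i) + L ^ 2 * (Q - g) = 0"
    using eq by (simp add: L_def algebra_simps)
  moreover have "(\<Sum>i=1..r. lin x i ^ a i * b i) = (\<Sum>i=1..r. lin x i ^ (a(Suc r := 2)) i * F i)"
    by (intro sum.cong) (auto simp: F_def)
  ultimately have "(\<Sum>i=1..Suc r. lin x i ^ (a(Suc r := 2)) i * F i) = 0"
    by (simp add: F_def L_def)
  moreover have "F i \<in> supported_on (reduced_support r a j i)" if "i \<in> {1..Suc r}" for i
  proof (cases "i = Suc r")
    case True
    have "- g \<in> tdeg_le (int j - 2)" using g by (simp add: tdeg_le_def)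
    with Q have "Q - g \<in> tdeg_le (int j - 2)" using tdeg_le_add by force
    then have "s + p + 2 \<le> j" if "coeff (coeff (Q - g) s) p \<noteq> 0" for s p
      using that unfolding tdeg_le_def by fastforce
    then show ?thesis using True by (simp add: F_def supported_on_def reduced_support_def)
  next
    case False
    then have i: "i \<in> {1..r}" using that by auto
    have "s \<le> 1 \<and> a i + s + p \<le> j" if nz: "coeff (coeff (b i) s) p \<noteq> 0" for s p
      using bq(2)[OF i] bq(4)[OF i, of s] nz unfolding tdeg_le_def by (cases "s \<ge> 2") force+
    then show ?thesis using i by (auto simp: F_def supported_on_def reduced_support_def)
  qed
  ultimately have "\<forall>i\<in>{1..Suc r}. F i = 0" using inj unfolding injective_at_def by blast
  then have "F (Suc r) = 0" by simp
  then have "g = Q" by (simp add: F_def)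
  then show "\<exists>q. (\<forall>i\<in>{1..r}. q i \<in> tdeg_le (int j - 2 - int (a i))) \<and> g = (\<Sum>i=1..r. lin x i ^ a i * q i)"
    using bq(3) unfolding Q_def by (intro exI[of _ q]) (simp add: algebra_simps)
qed

lemma square_injective_low_degree:
  assumes "j < 2" shows "square_injective r a j x"
proof -
  have "g = 0" if "g \<in> tdeg_le (j - 2)" for g :: "'a poly poly"
    using that assms by (intro poly_poly_eqI) (auto intro: tdeg_le_coeff_0)
  then show ?thesis
    unfolding square_injective_def by (auto intro!: exI[of _ "\<lambda>_. 0"] simp: tdeg_le_0)
qed

text \<open>A single power \<open>M^a\<close>. As a polynomial in \<open>z\<close>, \<open>L\<close> has one root \<open>w \<in> K[t]\<close>, and \<open>M\<close> does not vanish there.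
So \<open>L^2\<close> divides the remainder \<open>b\<close> of the cofactor, which has degree less than two in \<open>z\<close>.\<close>

lemma square_injective_one_form:
  fixes x :: "nat \<times> 3 \<Rightarrow> 'k::field_char_0"
  assumes nz: "x (2, 2) \<noteq> 0" and indep: "x (2, 2) * x (1, 0) - x (1, 2) * x (2, 0) \<noteq> 0"
  shows "square_injective 1 a j x"
  unfolding square_injective_def
proof (intro allI impI)
  fix f g assume f: "\<forall>i\<in>{1..1}. f i \<in> tdeg_le (j - int (a i))"
    and eq: "lin x (Suc 1) ^ 2 * g = (\<Sum>i=1..1. lin x i ^ a i * f i)"
  define L where "L = lin x 2"
  define M where "M = lin x 1"
  have "f 1 \<in> tdeg_le (j - int (a 1))" using f by simp
  then obtain b q where bq: "f 1 = b + L ^ 2 * q" "q \<in> tdeg_le (j - int (a 1) - 2)" "\<And>s. s \<ge> 2 \<Longrightarrow> coeff b s = 0"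
    using division_by_square[OF nz, of "[:x (2, 1), x (2, 0):]" "f 1" "j - int (a 1)"] tdeg_le_lin[of x 2]
    unfolding L_def lin_def by metis
  define w where "w = smult (- 1 / x (2, 2)) [:x (2, 1), x (2, 0):]"
  have L_eq: "L = smult [:x (2, 2):] [:- w, 1:]"
    using nz by (simp add: L_def lin_def w_def)
  \<comment> \<open>Up to the factor \<open>x (2, 2)\<close>, this coefficient is the minor in \<open>indep\<close>.\<close>
  have "coeff (poly M w) 1 \<noteq> 0"
    using nz indep by (simp add: M_def lin_def w_def field_simps)
  then have Mw: "poly (M ^ a 1) w \<noteq> 0" by auto
  have eq': "L ^ 2 * g = M ^ a 1 * (b + L ^ 2 * q)"
    using eq unfolding bq(1)[symmetric] by (simp add: L_def M_def numeral_2_eq_2)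
  have "b = 0"
  proof (rule ccontr)
    assume "b \<noteq> 0"
    have "M ^ a 1 * b = L ^ 2 * (g - M ^ a 1 * q)"
      using eq' by (simp add: algebra_simps)
    moreover have "[:- w, 1:] ^ 2 dvd L ^ 2"
      unfolding L_eq by (intro dvd_power_same dvd_smult dvd_refl)
    ultimately have "[:- w, 1:] ^ 2 dvd M ^ a 1 * b" by (metis dvd_mult2)
    moreover have "M ^ a 1 * b \<noteq> 0" using Mw \<open>b \<noteq> 0\<close> by (metis mult_eq_0_iff poly_0)
    ultimately have "2 \<le> Polynomial.order w (M ^ a 1) + Polynomial.order w b"
      by (simp only: order_divides order_mult simp_thms)
    also have "Polynomial.order w (M ^ a 1) = 0" using Mw by (rule order_0I)
    finally have "2 \<le> degree b" using order_degree[OF \<open>b \<noteq> 0\<close>, of w] by simp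
    then have "coeff b (degree b) = 0" by (rule bq(3))
    then show False using \<open>b \<noteq> 0\<close> by simp
  qed
  then have "L ^ 2 * g = L ^ 2 * (M ^ a 1 * q)"
    using eq' by (simp add: mult_ac)
  moreover have "L \<noteq> 0" using nz by (simp add: L_def lin_def)
  ultimately have "g = M ^ a 1 * q" by simp
  then show "\<exists>q. (\<forall>i\<in>{1..1}. q i \<in> tdeg_le (j - 2 - int (a i))) \<and> g = (\<Sum>i=1..1. lin x i ^ a i * q i)"
    using bq(2) by (intro exI[of _ "\<lambda>_. q"]) (simp add: M_def algebra_simps)
qed

text \<open>One polynomial function takes care of all degrees. For \<open>r \<ge> 2\<close> it combines the conditions for the
degrees up to \<open>a_1 + a_2\<close> with surjectivity in degree \<open>a_1 + a_2\<close> itself, which passes to larger degrees.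
For \<open>r = 1\<close> surjectivity fails in every large degree, so that an argument uniform in the degree is
used instead.\<close>

lemma generic_maximal_rank:
  fixes a :: "nat \<Rightarrow> nat"
  assumes "r > 0" and a: "\<And>i. i \<in> {1..r} \<Longrightarrow> a i > 0"
  shows "\<exists>F. polyfun ({1..Suc r} \<times> UNIV) F \<and> (\<exists>x. F x \<noteq> 0) \<and>
    (\<forall>x :: nat \<times> 3 \<Rightarrow> 'k::field_char_0. F x \<noteq> 0 \<longrightarrow>
      (\<forall>j. square_injective r a j x \<or> surjective_at (Suc r) (a(Suc r := 2)) j x))"
proof (cases "r = 1")
  case True
  define F where "F x = x (2, 2) * (x (2, 2) * x (1, 0) - x (1, 2) * x (2, 0))" for x :: "nat \<times> 3 \<Rightarrow> 'k"
  have "polyfun ({1..Suc r} \<times> UNIV) F"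
    unfolding F_def[abs_def] using True by (intro polyfun_mult polyfun_diff polyfun_coord) auto
  moreover have "F (\<lambda>(i, v). of_bool (i = 2 \<and> v = 2 \<or> i = 1 \<and> v = 0)) \<noteq> 0"
    by (simp add: F_def)
  moreover have "square_injective r a j x" if "F x \<noteq> 0" for x j
    unfolding True using that by (intro square_injective_one_form) (auto simp: F_def)
  ultimately show ?thesis by blast
next
  case False
  then have "r \<ge> 2" using assms(1) by simp
  define J where "J = a 1 + a 2"
  obtain G where G: "polyfun ({1..Suc r} \<times> UNIV) G" "\<exists>x. G x \<noteq> 0"
    "\<And>x :: nat \<times> 3 \<Rightarrow> 'k. G x \<noteq> 0 \<Longrightarrow> surjective_at (Suc r) (a(Suc r := 2)) (int J) x"
    using generic_surjective_in_large_degree[of r a, OF a \<open>r \<ge> 2\<close>] unfolding J_def by blast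
  have "\<forall>j. \<exists>F. j \<ge> 2 \<longrightarrow> polyfun ({1..Suc r} \<times> UNIV) F \<and> (\<exists>x. F x \<noteq> 0) \<and>
    (\<forall>x :: nat \<times> 3 \<Rightarrow> 'k. F x \<noteq> 0 \<longrightarrow>
      injective_at (Suc r) (a(Suc r := 2)) (reduced_support r a j) x \<or> surjective_at (Suc r) (a(Suc r := 2)) (int j) x)"
    using generic_rank_in_degree[of r a, OF a] by blast
  then obtain H where H: "\<And>j. j \<ge> 2 \<Longrightarrow> polyfun ({1..Suc r} \<times> UNIV) (H j)" "\<And>j. j \<ge> 2 \<Longrightarrow> \<exists>x. H j x \<noteq> 0"
    "\<And>j x. j \<ge> 2 \<Longrightarrow> H j x \<noteq> 0 \<Longrightarrow> injective_at (Suc r) (a(Suc r := 2)) (reduced_support r a j) (x :: nat \<times> 3 \<Rightarrow> 'k) \<or> surjective_at (Suc r) (a(Suc r := 2)) (int j) x"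
    by metis
  \<comment> \<open>Degrees \<open>0\<close> and \<open>1\<close> carry no condition of their own, so these indices hold the two conditions that are common to all degrees.\<close>
  define F where "F k = (if k = 0 then G else if k = 1 then (\<lambda>x. x (Suc r, 2)) else H k)" for k
  have "polyfun ({1..Suc r} \<times> UNIV) (F k)" for k
    unfolding F_def using G(1) H(1)[of k] polyfun_coord[of "(Suc r, 2)" "{1..Suc r} \<times> UNIV"] by auto
  moreover have "\<exists>x. F k x \<noteq> 0" for k
  proof -
    have "\<exists>x :: nat \<times> 3 \<Rightarrow> 'k. x (Suc r, 2) \<noteq> 0" by (rule exI[of _ "\<lambda>_. 1"]) simp
    then show ?thesis unfolding F_def using G(2) H(2)[of k] by auto
  qed
  ultimately have "\<exists>P. polyfun ({1..Suc r} \<times> UNIV) P \<and> (\<exists>x. P x \<noteq> 0) \<and> (\<forall>x. P x \<noteq> 0 \<longrightarrow> (\<forall>k\<in>{..J}. F k x \<noteq> 0))"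
    by (intro polyfun_prod_nonzero) simp_all
  then obtain P where P: "polyfun ({1..Suc r} \<times> UNIV) P" "\<exists>x. P x \<noteq> 0" "\<And>x k. P x \<noteq> 0 \<Longrightarrow> k \<le> J \<Longrightarrow> F k x \<noteq> 0"
    by (metis atMost_iff)
  have pos: "a 1 > 0" "a 2 > 0" using a[of 1] a[of 2] \<open>r \<ge> 2\<close> by auto
  have "square_injective r a j x \<or> surjective_at (Suc r) (a(Suc r := 2)) j x" if Px: "P x \<noteq> 0" for x j
  proof -
    have "F 0 x \<noteq> 0" "F 1 x \<noteq> 0"
      using P(3)[OF Px] pos by (auto simp: J_def)
    then have top: "surjective_at (Suc r) (a(Suc r := 2)) (int J) x" and nz: "x (Suc r, 2) \<noteq> 0"
      using G(3) by (auto simp: F_def)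
    consider "j < 2" | "2 \<le> j" "j \<le> int J" | "j \<ge> int J" by linarith
    then show ?thesis
    proof cases
      case 1
      then show ?thesis by (simp add: square_injective_low_degree)
    next
      case 2
      define k where "k = nat j"
      have k: "k \<ge> 2" "k \<le> J" "j = int k" using 2 by (auto simp: k_def)
      then have "H k x \<noteq> 0" using P(3)[OF Px, of k] by (auto simp: F_def)
      then show ?thesis using H(3)[OF k(1)] square_injective_if_injective_at[of r a k x, OF _ nz] unfolding k(3) by blast
    next
      case 3
      then show ?thesis using surjective_at_mono[OF top] by simp
    qed
  qed
  then show ?thesis using P(1,2) by blast
qed

section \<open>Dehomogenisation of ternary forms\<close>

interpretation const_hom: coefficient_hom "\<lambda>c::'k::field_char_0. [:[:c:]:]"
  by unfold_locales (simp_all add: one_pCons)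

definition dehom :: "'k::field_char_0 poly3 \<Rightarrow> 'k poly poly"
  where "dehom = mpoly_subst (\<lambda>c. [:[:c:]:]) (\<lambda>v. if v = 0 then [:[:0, 1:]:] else if v = 1 then 1 else [:0, 1:])"

lemma UNIV_3: "(UNIV :: 3 set) = {0, 1, 2}"
  by (intro card_subset_eq[symmetric]) auto

lemma eq_3_iff: "m = n \<longleftrightarrow> Poly_Mapping.lookup m 0 = Poly_Mapping.lookup n 0 \<and> Poly_Mapping.lookup m 1 = Poly_Mapping.lookup n 1
    \<and> Poly_Mapping.lookup m 2 = Poly_Mapping.lookup n (2::3)"
proof -
  have "m = n \<longleftrightarrow> (\<forall>v\<in>UNIV. Poly_Mapping.lookup m v = Poly_Mapping.lookup n v)"
    by (auto intro: poly_mapping_eqI)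
  then show ?thesis unfolding UNIV_3 by simp
qed

abbreviation mdeg :: "(3 \<Rightarrow>\<^sub>0 nat) \<Rightarrow> nat"
  where "mdeg m \<equiv> \<Sum>v\<in>UNIV. Poly_Mapping.lookup m v"

lemma mdeg_eq: "mdeg m = Poly_Mapping.lookup m 0 + Poly_Mapping.lookup m 1 + Poly_Mapping.lookup m 2"
  unfolding UNIV_3 by simp

lemma mdeg_add: "mdeg (m + n) = mdeg m + mdeg n"
  by (simp add: lookup_add sum.distrib)

lemma int_mdeg_single: "int (mdeg (Poly_Mapping.single v (Suc 0))) = 1"
  by (simp add: lookup_single when_def)

lemma dehom_single:
  "dehom (Poly_Mapping.single m c) = smult [:c:] (monom (monom 1 (Poly_Mapping.lookup m 0)) (Poly_Mapping.lookup m 2))"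
proof -
  have X: "[:[:0, 1::'a:]:] ^ n = [:monom 1 n:]" for n
    by (simp add: poly_const_pow monom_altdef)
  have Z: "[:0, 1::'a poly:] ^ n = monom 1 n" for n
    by (simp add: monom_altdef)
  have "monomial_value (\<lambda>v::3. if v = 0 then [:[:0, 1::'a:]:] else if v = 1 then 1 else [:0, 1:]) m =
      [:monom 1 (Poly_Mapping.lookup m 0):] * monom 1 (Poly_Mapping.lookup m 2)"
    by (subst monomial_value_superset[of UNIV]) (simp_all, unfold UNIV_3, simp add: X Z)
  then show ?thesis
    by (simp add: dehom_def const_hom.subst_single smult_monom)
qed

lemma dehom_add: "dehom (P + Q) = dehom P + dehom Q"
  and dehom_sum: "dehom (\<Sum>i\<in>A. f i) = (\<Sum>i\<in>A. dehom (f i))"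
  and dehom_mult: "dehom (P * Q) = dehom P * dehom Q"
  and dehom_power: "dehom (P ^ n) = dehom P ^ n"
  and dehom_0: "dehom 0 = 0"
  by (simp_all add: dehom_def const_hom.subst_add const_hom.subst_sum const_hom.subst_mult const_hom.subst_power const_hom.subst_0)

lemma coeff_dehom_sum: "coeff (coeff (dehom f) s) p =
    (\<Sum>m\<in>Poly_Mapping.keys f. if Poly_Mapping.lookup m 2 = s \<and> Poly_Mapping.lookup m 0 = p then Poly_Mapping.lookup f m else 0)"
proof -
  have "dehom f = (\<Sum>m\<in>Poly_Mapping.keys f. dehom (Poly_Mapping.single m (Poly_Mapping.lookup f m)))"
    by (subst mpoly_sum_monomials[of f]) (rule dehom_sum)
  then show ?thesis
    by (simp only: coeff_sum dehom_single) (intro sum.cong, auto)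
qed

text \<open>The exponent of the second variable is determined by the other two and the degree, so no information
about a form is lost.\<close>

lemma coeff_dehom:
  assumes "f \<in> homog j" "int (mdeg m) = j"
  shows "coeff (coeff (dehom f) (Poly_Mapping.lookup m 2)) (Poly_Mapping.lookup m 0) = Poly_Mapping.lookup f m"
proof -
  have "n = m" if "n \<in> Poly_Mapping.keys f" "Poly_Mapping.lookup n 2 = Poly_Mapping.lookup m 2" "Poly_Mapping.lookup n 0 = Poly_Mapping.lookup m 0" for n
  proof -
    have "int (mdeg n) = int (mdeg m)" using assms that(1) unfolding homog_def by blast
    then show ?thesis using that unfolding eq_3_iff mdeg_eq by simp
  qed
  then have "coeff (coeff (dehom f) (Poly_Mapping.lookup m 2)) (Poly_Mapping.lookup m 0) =
      (\<Sum>n\<in>Poly_Mapping.keys f. if n = m then Poly_Mapping.lookup f m else 0)"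
    unfolding coeff_dehom_sum by (intro sum.cong) auto
  then show ?thesis by (simp add: in_keys_iff)
qed

lemma dehom_tdeg_le: "f \<in> homog j \<Longrightarrow> dehom f \<in> tdeg_le j"
  unfolding tdeg_le_def
proof safe
  fix s p assume f: "f \<in> homog j" and nz: "coeff (coeff (dehom f) s) p \<noteq> 0"
  have "\<exists>m\<in>Poly_Mapping.keys f. Poly_Mapping.lookup m 2 = s \<and> Poly_Mapping.lookup m 0 = p"
  proof (rule ccontr)
    assume "\<not> ?thesis"
    then have "coeff (coeff (dehom f) s) p = 0"
      unfolding coeff_dehom_sum by (intro sum.neutral) auto
    with nz show False ..
  qed
  then obtain m where m: "m \<in> Poly_Mapping.keys f" "Poly_Mapping.lookup m 2 = s" "Poly_Mapping.lookup m 0 = p" by blast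
  then have "int (mdeg m) = j" using f unfolding homog_def by blast
  then show "int s + int p \<le> j" using m unfolding mdeg_eq by simp
qed

lemma dehom_eq_0_iff: "f \<in> homog j \<Longrightarrow> dehom f = 0 \<longleftrightarrow> f = 0"
proof
  assume f: "f \<in> homog j" and zero: "dehom f = 0"
  show "f = 0"
  proof (rule poly_mapping_eqI)
    fix m show "Poly_Mapping.lookup f m = Poly_Mapping.lookup 0 m"
    proof (cases "m \<in> Poly_Mapping.keys f")
      case True
      then have "int (mdeg m) = j" using f unfolding homog_def by blast
      from coeff_dehom[OF f this] show ?thesis by (simp add: zero)
    qed (simp add: in_keys_iff)
  qed
qed (simp add: dehom_0)

lemma homog_0: "0 \<in> homog j"
  by (simp add: homog_def)

lemma homog_single: "int (mdeg m) = j \<Longrightarrow> Poly_Mapping.single m c \<in> homog j"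
  by (auto simp: homog_def split: if_splits)

lemma homog_add: "f \<in> homog j \<Longrightarrow> g \<in> homog j \<Longrightarrow> f + g \<in> homog j"
  unfolding homog_def using keys_add[of f g] by blast

lemma homog_uminus: "f \<in> homog j \<Longrightarrow> - f \<in> homog j"
  unfolding homog_def by (auto simp: in_keys_iff)

lemma homog_diff: "f \<in> homog j \<Longrightarrow> g \<in> homog j \<Longrightarrow> f - g \<in> homog j"
  using homog_add[OF _ homog_uminus] by fastforce

lemma homog_sum: "(\<And>i. i \<in> A \<Longrightarrow> f i \<in> homog j) \<Longrightarrow> (\<Sum>i\<in>A. f i) \<in> homog j"
  by (induction A rule: infinite_finite_induct) (auto intro: homog_0 homog_add)

lemma homog_mult:
  assumes "f \<in> homog i" "g \<in> homog j" shows "f * g \<in> homog (i + j)"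
  unfolding homog_def
proof safe
  fix m assume "m \<in> Poly_Mapping.keys (f * g)"
  then obtain m1 m2 where m: "m = m1 + m2" "m1 \<in> Poly_Mapping.keys f" "m2 \<in> Poly_Mapping.keys g"
    using keys_mult[of f g] by blast
  then have "int (mdeg m1) = i" "int (mdeg m2) = j" using assms unfolding homog_def by blast+
  then show "int (mdeg m) = i + j" unfolding m(1) mdeg_add by simp
qed

lemma homog_power: "f \<in> homog 1 \<Longrightarrow> f ^ n \<in> homog (int n)"
proof (induction n)
  case 0
  show ?case using homog_single[of 0 0 1] by simp
next
  case (Suc n)
  from homog_mult[OF Suc.prems Suc.IH[OF Suc.prems]] show ?case by (simp add: algebra_simps)
qed

lemma homog_power_mult: "L \<in> homog 1 \<Longrightarrow> f \<in> homog (j - int n) \<Longrightarrow> L ^ n * f \<in> homog j"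
  using homog_mult[OF homog_power[of L n], of f "j - int n"] by simp

lemma dehom_surj:
  assumes "P \<in> tdeg_le j"
  obtains f where "f \<in> homog j" "dehom f = P"
proof -
  define K where "K = {(s, p). int s + int p \<le> j}"
  define m :: "nat \<times> nat \<Rightarrow> (3 \<Rightarrow>\<^sub>0 nat)" where
    "m = (\<lambda>(s, p). Poly_Mapping.single 0 p + Poly_Mapping.single 1 (nat (j - int s - int p)) + Poly_Mapping.single 2 s)"
  define f where "f = (\<Sum>sp\<in>K. Poly_Mapping.single (m sp) (coeff (coeff P (fst sp)) (snd sp)))"
  have m: "Poly_Mapping.lookup (m (s, p)) 0 = p" "Poly_Mapping.lookup (m (s, p)) 1 = nat (j - int s - int p)"
      "Poly_Mapping.lookup (m (s, p)) 2 = s" for s p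
    by (simp_all add: m_def lookup_add lookup_single)
  have "f \<in> homog j"
    unfolding f_def by (intro homog_sum homog_single) (auto simp: K_def mdeg_eq m)
  moreover have "dehom f = with_coeffs K (\<lambda>(s, p). coeff (coeff P s) p)"
    unfolding f_def with_coeffs_def dehom_sum dehom_single by (intro sum.cong) (auto simp: m)
  then have "dehom f = P"
    using with_coeffs_coeff[OF finite_triangle[of j], of P] assms by (simp add: tdeg_le_eq_supported K_def)
  ultimately show thesis by (rule that)
qed

lemma dehom_linear_form:
  assumes "Ls i \<in> homog 1"
  shows "dehom (Ls i) = lin (tuple_coord Ls) i"
proof (rule poly_poly_eqI)
  fix s p
  consider "s = 0" "p = 0" | "s = 0" "p = 1" | "s = 1" "p = 0" | "int s + int p > 1" by linarith
  then show "coeff (coeff (dehom (Ls i)) s) p = coeff (coeff (lin (tuple_coord Ls) i) s) p"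
  proof cases
    case 1
    then show ?thesis
      using coeff_dehom[OF assms int_mdeg_single, of 1] by (simp add: lookup_single lin_def tuple_coord_def)
  next
    case 2
    then show ?thesis
      using coeff_dehom[OF assms int_mdeg_single, of 0] by (simp add: lookup_single lin_def tuple_coord_def)
  next
    case 3
    then show ?thesis
      using coeff_dehom[OF assms int_mdeg_single, of 2] by (simp add: lookup_single lin_def tuple_coord_def)
  next
    case 4
    then show ?thesis
      using tdeg_le_coeff_0[OF dehom_tdeg_le[OF assms], of s p] tdeg_le_coeff_0[OF tdeg_le_lin, of s p "tuple_coord Ls" i] by simp
  qed
qed

definition hom_part :: "int \<Rightarrow> 'k::comm_ring_1 poly3 \<Rightarrow> 'k poly3"
  where "hom_part d f = (\<Sum>m\<in>{m \<in> Poly_Mapping.keys f. int (mdeg m) = d}. Poly_Mapping.single m (Poly_Mapping.lookup f m))"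

lemma lookup_hom_part: "Poly_Mapping.lookup (hom_part d f) m = (if int (mdeg m) = d then Poly_Mapping.lookup f m else 0)"
  by (auto simp: hom_part_def lookup_sum lookup_single when_def in_keys_iff sum.delta)

lemma hom_part_homog: "hom_part d f \<in> homog d"
  by (auto simp: homog_def in_keys_iff lookup_hom_part split: if_splits)

lemma hom_part_add: "hom_part d (f + g) = hom_part d f + hom_part d g"
  by (rule poly_mapping_eqI) (simp add: lookup_hom_part lookup_add)

lemma hom_part_0: "hom_part d 0 = 0"
  by (rule poly_mapping_eqI) (simp add: lookup_hom_part)

lemma hom_part_sum: "hom_part d (\<Sum>i\<in>A. f i) = (\<Sum>i\<in>A. hom_part d (f i))"
  by (induction A rule: infinite_finite_induct) (simp_all add: hom_part_0 hom_part_add)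

lemma hom_part_of_homog: "f \<in> homog e \<Longrightarrow> hom_part d f = (if d = e then f else 0)"
  by (rule poly_mapping_eqI) (auto simp: lookup_hom_part homog_def in_keys_iff)

text \<open>By additivity this need only be checked for a monomial \<open>f\<close>, where both sides are \<open>g f\<close> or zero.\<close>

lemma hom_part_mult:
  assumes "g \<in> homog e"
  shows "hom_part d (g * f) = g * hom_part (d - e) f"
proof -
  have "hom_part d (g * Poly_Mapping.single m c) = g * hom_part (d - e) (Poly_Mapping.single m c)" for m c
    using hom_part_of_homog[OF homog_mult[OF assms homog_single[OF refl, of m c]], of d]
      hom_part_of_homog[OF homog_single[OF refl, of m c], of "d - e"] by auto
  then have "hom_part d (g * (\<Sum>m\<in>A. Poly_Mapping.single m (c m))) = g * hom_part (d - e) (\<Sum>m\<in>A. Poly_Mapping.single m (c m))" for A c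
    by (simp only: sum_distrib_left hom_part_sum)
  from this[where A = "Poly_Mapping.keys f" and c = "Poly_Mapping.lookup f"] show ?thesis
    by (simp only: mpoly_sum_monomials[symmetric])
qed


section \<open>The ideal of powers and multiplication on its quotient\<close>

lemma ring_of_type_simps:
  "partial_object.carrier (ring_of_type_algebra :: 'a::comm_ring_1 ring) = UNIV"
  "monoid.mult (ring_of_type_algebra :: 'a ring) = (*)"
  "ring.add (ring_of_type_algebra :: 'a ring) = (+)"
  "ring.zero (ring_of_type_algebra :: 'a ring) = 0"
  by (simp_all add: ring_of_type_algebra_def)

lemma ideal_ring_of_typeI:
  fixes S :: "'a::comm_ring_1 set"
  assumes "0 \<in> S" "\<And>f g. f \<in> S \<Longrightarrow> g \<in> S \<Longrightarrow> f + g \<in> S" "\<And>f g. f \<in> S \<Longrightarrow> g * f \<in> S"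
  shows "ideal S (ring_of_type_algebra :: 'a ring)"
proof -
  let ?R = "ring_of_type_algebra :: 'a ring"
  interpret ring ?R by (rule ring_from_type_algebra)
  have inv: "inv\<^bsub>add_monoid ?R\<^esub> f = - f" for f
    by (rule group.inv_equality[OF a_group]) (simp_all add: ring_of_type_simps)
  have "subgroup S (add_monoid ?R)"
  proof (rule group.subgroupI[OF a_group])
    fix f assume "f \<in> S"
    then show "inv\<^bsub>add_monoid ?R\<^esub> f \<in> S" using assms(3)[of f "-1"] unfolding inv by simp
  qed (use assms in \<open>auto simp: ring_of_type_simps\<close>)
  then show ?thesis
  proof (rule idealI[OF ring_axioms])
    fix f g assume "f \<in> S"
    then show "g \<otimes>\<^bsub>?R\<^esub> f \<in> S" "f \<otimes>\<^bsub>?R\<^esub> g \<in> S"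
      using assms(3)[of f g] by (simp_all add: ring_of_type_simps mult.commute)
  qed
qed

lemma power_ideal_ideal: "ideal (power_ideal r a Ls) poly3_ring"
  unfolding power_ideal_def by (rule ring.genideal_ideal[OF ring_from_type_algebra]) (simp add: ring_of_type_simps)

text \<open>The combinations of the powers form an ideal that contains them and lies in every ideal that does.\<close>

lemma mem_power_ideal_iff: "f \<in> power_ideal r a Ls \<longleftrightarrow> (\<exists>q. f = (\<Sum>i=1..r. Ls i ^ a i * q i))"
proof
  let ?S = "{f. \<exists>q. f = (\<Sum>i=1..r. Ls i ^ a i * q i)}"
  have "ideal ?S poly3_ring"
  proof (rule ideal_ring_of_typeI)
    show "0 \<in> ?S" by (auto intro!: exI[of _ "\<lambda>_. 0"])
  next
    fix f g assume "f \<in> ?S" "g \<in> ?S"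
    then obtain p q where "f = (\<Sum>i=1..r. Ls i ^ a i * p i)" "g = (\<Sum>i=1..r. Ls i ^ a i * q i)" by blast
    then have "f + g = (\<Sum>i=1..r. Ls i ^ a i * (p i + q i))"
      by (simp add: distrib_left sum.distrib)
    then show "f + g \<in> ?S" unfolding mem_Collect_eq by (intro exI[of _ "\<lambda>i. p i + q i"])
  next
    fix f g assume "f \<in> ?S"
    then obtain p where "f = (\<Sum>i=1..r. Ls i ^ a i * p i)" by blast
    then have "g * f = (\<Sum>i=1..r. Ls i ^ a i * (g * p i))"
      by (simp add: sum_distrib_left mult.left_commute)
    then show "g * f \<in> ?S" unfolding mem_Collect_eq by (intro exI[of _ "\<lambda>i. g * p i"])
  qed
  moreover have "(\<lambda>i. Ls i ^ a i) ` {1..r} \<subseteq> ?S"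
  proof clarify
    fix k assume "k \<in> {1..r}"
    then show "\<exists>q. Ls k ^ a k = (\<Sum>i=1..r. Ls i ^ a i * q i)"
      by (intro exI[of _ "\<lambda>i. of_bool (i = k)"]) (simp add: of_bool_def if_distrib cong: if_cong)
  qed
  ultimately have "power_ideal r a Ls \<subseteq> ?S"
    unfolding power_ideal_def by (rule ring.genideal_minimal[OF ring_from_type_algebra])
  then show "f \<in> power_ideal r a Ls \<Longrightarrow> \<exists>q. f = (\<Sum>i=1..r. Ls i ^ a i * q i)" by blast
next
  assume "\<exists>q. f = (\<Sum>i=1..r. Ls i ^ a i * q i)"
  then obtain q where q: "f = (\<Sum>i=1..r. Ls i ^ a i * q i)" by blast
  interpret ideal "power_ideal r a Ls" poly3_ring by (rule power_ideal_ideal)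
  have gens: "Ls i ^ a i \<in> power_ideal r a Ls" if "i \<in> {1..r}" for i
    using that ring.genideal_self[OF ring_from_type_algebra, of "(\<lambda>i. Ls i ^ a i) ` {1..r}"]
    by (auto simp: power_ideal_def ring_of_type_simps)
  have "(\<Sum>i\<in>A. Ls i ^ a i * q i) \<in> power_ideal r a Ls" if "A \<subseteq> {1..r}" for A
    using finite_subset[OF that finite_atLeastAtMost] that
  proof (induction A rule: finite_induct)
    case empty
    then show ?case using additive_subgroup.zero_closed[OF is_additive_subgroup] by (simp add: ring_of_type_simps)
  next
    case (insert i A)
    then have "Ls i ^ a i * q i \<in> power_ideal r a Ls"
      using I_r_closed[OF gens, of i "q i"] by (simp add: ring_of_type_simps)
    then show ?case
      using insert additive_subgroup.a_closed[OF is_additive_subgroup] by (simp add: ring_of_type_simps)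
  qed
  then show "f \<in> power_ideal r a Ls" unfolding q by blast
qed

text \<open>The cofactors can be taken homogeneous: replace them by their components of the right degree.\<close>

lemma homog_mem_power_ideal:
  assumes "f \<in> power_ideal r a Ls" "f \<in> homog j" "\<And>i. i \<in> {1..r} \<Longrightarrow> Ls i \<in> homog 1"
  obtains q where "\<And>i. q i \<in> homog (j - int (a i))" "f = (\<Sum>i=1..r. Ls i ^ a i * q i)"
proof -
  obtain p where p: "f = (\<Sum>i=1..r. Ls i ^ a i * p i)"
    using assms(1) unfolding mem_power_ideal_iff by blast
  have "f = hom_part j f" using hom_part_of_homog[OF assms(2)] by simp
  also have "\<dots> = (\<Sum>i=1..r. Ls i ^ a i * hom_part (j - int (a i)) (p i))"
    unfolding p hom_part_sum by (intro sum.cong hom_part_mult homog_power assms) auto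
  finally show thesis by (rule that[OF hom_part_homog])
qed

lemma coset_eq_iff:
  fixes f g :: "'k::comm_ring_1 poly3"
  assumes "ideal I poly3_ring"
  shows "I +>\<^bsub>poly3_ring\<^esub> f = I +>\<^bsub>poly3_ring\<^esub> g \<longleftrightarrow> f - g \<in> I"
proof -
  interpret ideal I poly3_ring by fact
  have mem: "h \<in> I +>\<^bsub>poly3_ring\<^esub> f \<longleftrightarrow> h - f \<in> I" for h f
  proof
    assume "h - f \<in> I"
    moreover have "h = (h - f) + f" by simp
    ultimately show "h \<in> I +>\<^bsub>poly3_ring\<^esub> f" unfolding a_r_coset_def' ring_of_type_simps by blast
  qed (auto simp: a_r_coset_def' ring_of_type_simps)
  have add: "p + q \<in> I" if "p \<in> I" "q \<in> I" for p q
    using additive_subgroup.a_closed[OF is_additive_subgroup that] by (simp add: ring_of_type_simps)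
  have neg: "- p \<in> I" if "p \<in> I" for p
    using I_l_closed[OF that, of "-1"] by (simp add: ring_of_type_simps)
  have zero: "0 \<in> I" using additive_subgroup.zero_closed[OF is_additive_subgroup] by (simp add: ring_of_type_simps)
  show ?thesis
  proof
    assume "I +>\<^bsub>poly3_ring\<^esub> f = I +>\<^bsub>poly3_ring\<^esub> g"
    then show "f - g \<in> I" using mem[of f f] mem[of f g] zero by simp
  next
    assume fg: "f - g \<in> I"
    have "h - f \<in> I \<longleftrightarrow> h - g \<in> I" for h
      using add[OF _ fg, of "h - f"] add[OF _ neg[OF fg], of "h - g"] by auto
    then show "I +>\<^bsub>poly3_ring\<^esub> f = I +>\<^bsub>poly3_ring\<^esub> g" using mem by blast
  qed
qed

lemma quot_mult_coset:
  assumes "ideal I poly3_ring"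
  shows "quot_mult I g (I +>\<^bsub>poly3_ring\<^esub> f) = I +>\<^bsub>poly3_ring\<^esub> (g * f)"
  using ideal.rcoset_mult_add[OF assms, of g f] by (simp add: quot_mult_def FactRing_def ring_of_type_simps)

text \<open>Maximal rank, translated from cosets to representatives.\<close>

lemma maximal_rank_quot_mult:
  assumes I: "ideal I poly3_ring" and g: "\<And>f. f \<in> homog (j - 2) \<Longrightarrow> g * f \<in> homog j"
    and "(\<forall>f\<in>homog (j - 2). g * f \<in> I \<longrightarrow> f \<in> I) \<or> (\<forall>h\<in>homog j. \<exists>f\<in>homog (j - 2). h - g * f \<in> I)"
  shows "maximal_rank (quot_mult I g) (quot_homog I (j - 2)) (quot_homog I j)"
  using assms(3)
proof
  assume inj: "\<forall>f\<in>homog (j - 2). g * f \<in> I \<longrightarrow> f \<in> I"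
  have "f - f' \<in> I" if "f \<in> homog (j - 2)" "f' \<in> homog (j - 2)" "g * f - g * f' \<in> I" for f f'
    using inj homog_diff[OF that(1,2)] that(3) by (simp add: right_diff_distrib)
  then have "inj_on (quot_mult I g) (quot_homog I (j - 2))"
    by (auto simp: inj_on_def quot_homog_def quot_mult_coset[OF I] coset_eq_iff[OF I])
  then show ?thesis by (simp add: maximal_rank_def)
next
  assume surj: "\<forall>h\<in>homog j. \<exists>f\<in>homog (j - 2). h - g * f \<in> I"
  have "quot_mult I g ` quot_homog I (j - 2) = quot_homog I j"
  proof
    show "quot_mult I g ` quot_homog I (j - 2) \<subseteq> quot_homog I j"
      using g by (auto simp: quot_homog_def quot_mult_coset[OF I])
    show "quot_homog I j \<subseteq> quot_mult I g ` quot_homog I (j - 2)"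
    proof
      fix C assume "C \<in> quot_homog I j"
      then obtain h where h: "h \<in> homog j" "C = I +>\<^bsub>poly3_ring\<^esub> h" unfolding quot_homog_def by blast
      then obtain f where "f \<in> homog (j - 2)" "h - g * f \<in> I" using surj by blast
      then show "C \<in> quot_mult I g ` quot_homog I (j - 2)"
        using h coset_eq_iff[OF I, of h "g * f"] quot_mult_coset[OF I, of g f] unfolding quot_homog_def by blast
    qed
  qed
  then show ?thesis by (simp add: maximal_rank_def)
qed


section \<open>Maximal rank on the quotient for general linear forms\<close>

lemma maximal_rank_if_generic:
  fixes Ls :: "nat \<Rightarrow> 'k::field_char_0 poly3"
  assumes Ls: "\<And>i. i \<in> {1..Suc r} \<Longrightarrow> Ls i \<in> homog 1"
    and x: "x = tuple_coord Ls"
    and rank: "square_injective r a j x \<or> surjective_at (Suc r) (a(Suc r := 2)) j x"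
  shows "maximal_rank (quot_mult (power_ideal r a Ls) (Ls (Suc r) ^ 2))
    (quot_homog (power_ideal r a Ls) (j - 2)) (quot_homog (power_ideal r a Ls) j)"
proof (rule maximal_rank_quot_mult[OF power_ideal_ideal])
  have L: "Ls (Suc r) \<in> homog 1" using Ls by simp
  show g: "Ls (Suc r) ^ 2 * f \<in> homog j" if "f \<in> homog (j - 2)" for f
    using homog_power_mult[OF L, of f j 2] that by simp
  have lin: "dehom (Ls i) = lin x i" if "i \<in> {1..Suc r}" for i
    unfolding x by (rule dehom_linear_form[of Ls i, OF Ls[OF that]])
  have dehom_comb: "dehom (\<Sum>i=1..r. Ls i ^ a i * q i) = (\<Sum>i=1..r. lin x i ^ a i * dehom (q i))" for q
    unfolding dehom_sum by (intro sum.cong) (auto simp: dehom_mult dehom_power lin)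
  have comb_homog: "(\<Sum>i=1..r. Ls i ^ a i * q i) \<in> homog d" if "\<And>i. i \<in> {1..r} \<Longrightarrow> q i \<in> homog (d - int (a i))" for q d
    using that Ls by (intro homog_sum homog_power_mult) auto
  have lift: "\<exists>p. \<forall>i\<in>{1..r}. p i \<in> homog (d - int (a i)) \<and> dehom (p i) = q i"
    if "\<forall>i\<in>{1..r}. q i \<in> tdeg_le (d - int (a i))" for q d
  proof -
    have "\<forall>i\<in>{1..r}. \<exists>p. p \<in> homog (d - int (a i)) \<and> dehom p = q i"
    proof
      fix i assume "i \<in> {1..r}"
      with that have "q i \<in> tdeg_le (d - int (a i))" by blast
      then show "\<exists>p. p \<in> homog (d - int (a i)) \<and> dehom p = q i" by (rule dehom_surj) blast
    qed
    then show ?thesis by (rule bchoice)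
  qed
  have eq_if_dehom_eq: "f = f'" if "f \<in> homog d" "f' \<in> homog d" "dehom f = dehom f'" for f f' :: "'k poly3" and d
  proof -
    have "dehom (f' + (f - f')) = dehom f' + dehom (f - f')" by (rule dehom_add)
    then have "dehom (f - f') = 0" using that(3) by simp
    then show ?thesis using dehom_eq_0_iff[OF homog_diff[OF that(1,2)]] by simp
  qed
  show "(\<forall>f\<in>homog (j - 2). Ls (Suc r) ^ 2 * f \<in> power_ideal r a Ls \<longrightarrow> f \<in> power_ideal r a Ls) \<or>
    (\<forall>h\<in>homog j. \<exists>f\<in>homog (j - 2). h - Ls (Suc r) ^ 2 * f \<in> power_ideal r a Ls)"
    using rank
  proof
    assume inj: "square_injective r a j x"
    have "f \<in> power_ideal r a Ls" if f: "f \<in> homog (j - 2)" and mem: "Ls (Suc r) ^ 2 * f \<in> power_ideal r a Ls" for f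
    proof -
      obtain p where p: "\<And>i. p i \<in> homog (j - int (a i))" "Ls (Suc r) ^ 2 * f = (\<Sum>i=1..r. Ls i ^ a i * p i)"
        using homog_mem_power_ideal[OF mem g[OF f]] Ls by auto
      have "lin x (Suc r) ^ 2 * dehom f = (\<Sum>i=1..r. lin x i ^ a i * dehom (p i))"
        using arg_cong[OF p(2), of dehom] unfolding dehom_comb by (simp add: dehom_mult dehom_power lin)
      then obtain q where q: "\<forall>i\<in>{1..r}. q i \<in> tdeg_le (j - 2 - int (a i))" "dehom f = (\<Sum>i=1..r. lin x i ^ a i * q i)"
        using inj p(1) f dehom_tdeg_le unfolding square_injective_def by meson
      obtain p' where p': "\<forall>i\<in>{1..r}. p' i \<in> homog (j - 2 - int (a i)) \<and> dehom (p' i) = q i"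
        using lift[OF q(1)] by blast
      have "dehom f = dehom (\<Sum>i=1..r. Ls i ^ a i * p' i)"
        unfolding dehom_comb q(2) by (intro sum.cong) (use p' in auto)
      then have "f = (\<Sum>i=1..r. Ls i ^ a i * p' i)"
        using p' by (intro eq_if_dehom_eq[OF f] comb_homog) auto
      then show ?thesis unfolding mem_power_ideal_iff by blast
    qed
    then show ?thesis by blast
  next
    assume surj: "surjective_at (Suc r) (a(Suc r := 2)) j x"
    have "\<exists>f\<in>homog (j - 2). h - Ls (Suc r) ^ 2 * f \<in> power_ideal r a Ls" if h: "h \<in> homog j" for h
    proof -
      obtain q where q: "\<forall>i\<in>{1..Suc r}. q i \<in> tdeg_le (j - int ((a(Suc r := 2)) i))"
        "dehom h = (\<Sum>i=1..Suc r. lin x i ^ (a(Suc r := 2)) i * q i)"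
        using surj dehom_tdeg_le[OF h] unfolding surjective_at_def by blast
      have "q i \<in> tdeg_le (j - int (a i))" if "i \<in> {1..r}" for i
        using bspec[OF q(1), of i] that by simp
      then have "\<forall>i\<in>{1..r}. q i \<in> tdeg_le (j - int (a i))" by blast
      then obtain p where p: "\<forall>i\<in>{1..r}. p i \<in> homog (j - int (a i)) \<and> dehom (p i) = q i"
        using lift by blast
      have "q (Suc r) \<in> tdeg_le (j - 2)" using bspec[OF q(1), of "Suc r"] by simp
      then obtain f where f: "f \<in> homog (j - 2)" "dehom f = q (Suc r)" by (rule dehom_surj)
      have "dehom h = (\<Sum>i=1..r. lin x i ^ a i * q i) + lin x (Suc r) ^ 2 * q (Suc r)"
        unfolding q(2) by simp
      also have "(\<Sum>i=1..r. lin x i ^ a i * q i) = dehom (\<Sum>i=1..r. Ls i ^ a i * p i)"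
        unfolding dehom_comb by (intro sum.cong) (use p in auto)
      finally have "dehom h = dehom ((\<Sum>i=1..r. Ls i ^ a i * p i) + Ls (Suc r) ^ 2 * f)"
        using f(2) by (simp add: dehom_add dehom_mult dehom_power lin)
      then have "h = (\<Sum>i=1..r. Ls i ^ a i * p i) + Ls (Suc r) ^ 2 * f"
        using p f g by (intro eq_if_dehom_eq[OF h] homog_add comb_homog) auto
      then have "h - Ls (Suc r) ^ 2 * f = (\<Sum>i=1..r. Ls i ^ a i * p i)" by simp
      then show ?thesis using f(1) unfolding mem_power_ideal_iff by blast
    qed
    then show ?thesis by blast
  qed
qed

lemma zariski_open_nonvanishing:
  assumes "polyfun ({1..n} \<times> UNIV) F"
  shows "zariski_open n {Ls \<in> linear_tuples n. F (tuple_coord Ls) \<noteq> 0}"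
proof -
  obtain P where "\<forall>m\<in>Poly_Mapping.keys P. Poly_Mapping.keys m \<subseteq> {1..n} \<times> UNIV" "\<forall>x. mpoly_eval x P = F x"
    using polyfun_mpoly_eval[OF assms] by blast
  then show ?thesis unfolding zariski_open_def by (intro exI[of _ "{P}"]) auto
qed

lemma polyfun_cong:
  assumes "polyfun V F" "\<And>v. v \<in> V \<Longrightarrow> x v = y v" shows "F x = F y"
  using assms by induction auto

text \<open>Every choice of coordinates comes from a tuple of linear forms. This turns a point where a polynomial
function does not vanish into an element of the open set.\<close>

lemma tuple_with_coords:
  fixes x :: "nat \<times> 3 \<Rightarrow> 'k::comm_ring_1"
  shows "\<exists>Ls :: nat \<Rightarrow> 'k poly3. Ls \<in> linear_tuples n \<and> (\<forall>i\<in>{1..n}. \<forall>v. tuple_coord Ls (i, v) = x (i, v))"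
proof -
  define Ls :: "nat \<Rightarrow> 'k poly3" where "Ls = (\<lambda>i\<in>{1..n}. \<Sum>v\<in>UNIV. Poly_Mapping.single (Poly_Mapping.single v 1) (x (i, v)))"
  have "Ls \<in> linear_tuples n"
    unfolding linear_tuples_def Ls_def
    by (intro restrict_PiE[THEN iffD2] Pi_I homog_sum homog_single) (simp add: lookup_single when_def)
  moreover have "Poly_Mapping.single v (Suc 0) = Poly_Mapping.single w (Suc 0) \<longleftrightarrow> v = w" for v w :: 3
    by (auto dest: arg_cong[of _ _ Poly_Mapping.keys])
  then have "tuple_coord Ls (i, v) = x (i, v)" if "i \<in> {1..n}" for i v
    using that by (simp add: tuple_coord_def Ls_def lookup_sum lookup_single when_def)
  ultimately show ?thesis by blast
qed

theorem theorem1p1: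
  fixes r :: nat and a :: "nat \<Rightarrow> nat"
  assumes "r > 0" and "\<And>i. i \<in> {1..r} \<Longrightarrow> a i > 0"
  shows "\<exists>U :: (nat \<Rightarrow> 'k::field_char_0 poly3) set.
    zariski_open (r + 1) U \<and> U \<noteq> {} \<and>
    (\<forall>Ls\<in>U. let I = power_ideal r a Ls; L = Ls (r + 1) in
       artinian_quot I \<longrightarrow>
       (\<forall>j::int. maximal_rank (quot_mult I (L ^ 2)) (quot_homog I (j - 2)) (quot_homog I j)))"
proof -
  obtain F and x :: "nat \<times> 3 \<Rightarrow> 'k" where F: "polyfun ({1..Suc r} \<times> UNIV) F" "F x \<noteq> 0"
    "\<And>x j. F x \<noteq> 0 \<Longrightarrow> square_injective r a j x \<or> surjective_at (Suc r) (a(Suc r := 2)) j x"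
    using generic_maximal_rank[of r a, OF assms] by blast
  define U where "U = {Ls \<in> linear_tuples (Suc r). F (tuple_coord Ls) \<noteq> 0}"
  obtain Ls where Ls: "Ls \<in> linear_tuples (Suc r)" "\<forall>i\<in>{1..Suc r}. \<forall>v. tuple_coord Ls (i, v) = x (i, v)"
    using tuple_with_coords by blast
  have "F (tuple_coord Ls) = F x" using Ls(2) by (intro polyfun_cong[OF F(1)]) auto
  then have "U \<noteq> {}" using Ls(1) F(2) by (auto simp: U_def)
  moreover have "zariski_open (Suc r) U"
    unfolding U_def by (rule zariski_open_nonvanishing[OF F(1)])
  moreover have "maximal_rank (quot_mult (power_ideal r a Ls) (Ls (Suc r) ^ 2))
      (quot_homog (power_ideal r a Ls) (j - 2)) (quot_homog (power_ideal r a Ls) j)" if "Ls \<in> U" for Ls j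
    by (rule maximal_rank_if_generic[OF _ refl F(3)]) (use that in \<open>auto simp: U_def linear_tuples_def\<close>)
  ultimately show ?thesis
    by (intro exI[of _ U]) (simp add: Let_def)
qed

end
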